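(* Let $d,k\ge 1$ and $n\ge 0$ be integers, and let $\overline{M[d]}^+_k(n)$ denote the $k$th positive moment of the $d$th residual crank of overpartitions of $n$ (defined in the context). Then $$\overline{M[d+1]}^+_k(n)\le \overline{M[d]}^+_k(n),$$ with equality if and only if $\overline{M[d]}^+_k(n)=0$, and $\overline{M[d]}^+_k(n)=0$ holds if and only if $n<d$.
   Context: An overpartition of $n$ is a non-increasing sequence of positive integers summing to $n$ in which the first occurrence of each distinct part value may be overlined. For an ordinary partition $\mu$, let $\omega(\mu)$ be the number of parts equal to $1$; the crank $cr(\mu)$ is the largest part of $\mu$ if $\omega(\mu)=0$ (with $cr(\emptyset)=0$), and otherwise is the number of parts of $\mu$ exceeding $\omega(\mu)$ minus $\omega(\mu)$. Following the Andrews–Garvan convention, define weights $c_m(\mu)$ for $m\in\mathbb Z$: if $\mu\ne(1)$ then $c_m(\mu)=1$ if $cr(\mu)=m$ and $0$ otherwise; for $\mu=(1)$ set $c_1=c_{-1}=1$, $c_0=-1$, and $c_m=0$ for other $m$. For an overpartition $\lambda$ and integer $d\ge1$, let $\lambda'$ be the partition formed by the non-overlined parts of $\lambda$ that are divisible by $d$, each divided by $d$; the $d$th residual crank of $\lambda$ is $cr(\lambda')$. Set $\overline{M[d]}(m,n)=\sum_{\lambda} c_m(\lambda')$, the sum over all overpartitions $\lambda$ of $n$, and define the $k$th positive moment $\overline{M[d]}^+_k(n)=\sum_{m\ge1} m^k\,\overline{M[d]}(m,n)$. *)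

theory Defs
  imports Complex_Main
begin

text \<open>Partitions are non-increasing lists of positive integers.\<close>

definition ones :: "nat list \<Rightarrow> nat" where
  "ones \<mu> = length (filter (\<lambda>p. p = 1) \<mu>)"

definition crank :: "nat list \<Rightarrow> int" where
  "crank \<mu> =
     (if ones \<mu> = 0 then (if \<mu> = [] then 0 else int (Max (set \<mu>)))
      else int (length (filter (\<lambda>p. p > ones \<mu>) \<mu>)) - int (ones \<mu>))"

text \<open>The Andrews--Garvan weight \<open>c\<^sub>m(\<mu>)\<close>.\<close>

definition crank_weight :: "int \<Rightarrow> nat list \<Rightarrow> int" where
  "crank_weight m \<mu> =
     (if \<mu> = [1] then (if m = 1 \<or> m = - 1 then 1 else if m = 0 then - 1 else 0)
      else if crank \<mu> = m then 1 else 0)"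

text \<open>An overpartition is a list of pairs (part, overlined?).\<close>

definition overpartitions :: "nat \<Rightarrow> (nat \<times> bool) list set" where
  "overpartitions n =
     {xs. sorted_wrt (\<ge>) (map fst xs) \<and> (\<forall>p \<in> set (map fst xs). p \<ge> 1) \<and>
          sum_list (map fst xs) = n \<and>
          (\<forall>i < length xs. snd (xs ! i) \<longrightarrow> (\<forall>j < i. fst (xs ! j) \<noteq> fst (xs ! i)))}"

definition residual_partition :: "nat \<Rightarrow> (nat \<times> bool) list \<Rightarrow> nat list" where
  "residual_partition d xs =
     map (\<lambda>x. fst x div d) (filter (\<lambda>x. \<not> snd x \<and> d dvd fst x) xs)"

definition residual_crank_count :: "nat \<Rightarrow> int \<Rightarrow> nat \<Rightarrow> int" where
  "residual_crank_count d m n =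
     (\<Sum>xs \<in> overpartitions n. crank_weight m (residual_partition d xs))"

text \<open>The sum over all \<open>m \<ge> 1\<close> is taken over its support, which is finite, as is the
  set of overpartitions of \<open>n\<close> (see the lemmas below), so no sum here is degenerate.\<close>

definition residual_crank_pos_moment :: "nat \<Rightarrow> nat \<Rightarrow> nat \<Rightarrow> int" where
  "residual_crank_pos_moment d k n =
     (\<Sum>m \<in> {m. m \<ge> 1 \<and> residual_crank_count d m n \<noteq> 0}.
        m ^ k * residual_crank_count d m n)"

lemma finite_overpartitions: "finite (overpartitions n)"
proof (rule finite_subset)
  show "overpartitions n \<subseteq> {xs. set xs \<subseteq> {1..n} \<times> UNIV \<and> length xs \<le> n}"
  proof
    fix xs assume xs: "xs \<in> overpartitions n"
    have pos: "\<forall>p \<in> set (map fst xs). p \<ge> 1" and s: "sum_list (map fst xs) = n"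
      using xs by (auto simp: overpartitions_def)
    have "set xs \<subseteq> {1..n} \<times> UNIV"
    proof
      fix x assume "x \<in> set xs"
      then have "fst x \<in> set (map fst xs)" by simp
      with pos s member_le_sum_list[of "fst x" "map fst xs"]
      have "fst x \<in> {1..n}" by auto
      then show "x \<in> {1..n} \<times> UNIV" by (cases x) auto
    qed
    moreover have "length ys \<le> sum_list ys" if "\<forall>p \<in> set ys. p \<ge> 1" for ys :: "nat list"
      using that by (induction ys) auto
    from this[OF pos] s have "length xs \<le> n" by simp
    ultimately show "xs \<in> {xs. set xs \<subseteq> {1..n} \<times> UNIV \<and> length xs \<le> n}" by simp
  qed
  show "finite {xs. set xs \<subseteq> {1..n} \<times> (UNIV :: bool set) \<and> length xs \<le> n}"
    by (rule finite_lists_length_le) simp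
qed

lemma finite_residual_crank_count_support:
  "finite {m. residual_crank_count d m n \<noteq> 0}"
proof (rule finite_subset)
  let ?C = "(\<lambda>xs. crank (residual_partition d xs)) ` overpartitions n"
  show "{m. residual_crank_count d m n \<noteq> 0} \<subseteq> ?C \<union> {- 1, 0, 1}"
  proof
    fix m assume "m \<in> {m. residual_crank_count d m n \<noteq> 0}"
    then obtain xs where "xs \<in> overpartitions n"
      and "crank_weight m (residual_partition d xs) \<noteq> 0"
      unfolding residual_crank_count_def using sum.not_neutral_contains_not_neutral by blast
    then show "m \<in> ?C \<union> {- 1, 0, 1}"
      by (auto simp: crank_weight_def split: if_splits)
  qed
  show "finite (?C \<union> {- 1, 0, 1})" by (simp add: finite_overpartitions)
qed

end

theory Submission
  imports Defs "HOL-Library.Multiset"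
begin

text \<open>
  Let \<open>p(n)\<close> and \<open>P(n)\<close> count partitions and overpartitions. For \<open>m \<ge> 1\<close> let \<open>C(m, s)\<close> count the
  partitions of \<open>s\<close> of crank at least \<open>m\<close>. Durfee rectangles give
  \<open>C(m, s) + C(m + 1, s - m) = p(s - m)\<close>, hence \<open>C(m, s)\<close> is the sum over \<open>j \<ge> 1\<close> of
  \<open>(-1)^(j-1) p(s - E(j, m))\<close> with \<open>E(j, m) = m + (m + 1) + \<dots> + (m + j - 1)\<close>. Summing against
  \<open>m^k - (m - 1)^k\<close> turns the \<open>k\<close>th positive crank moment of \<open>s\<close> into \<open>\<Sum>y. g(y) p(s - y)\<close>. Here
  \<open>g(y) \<ge> 0\<close>, because every run of consecutive integers of even length and sum \<open>y\<close> is matched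
  injectively with a run of odd length and sum \<open>y\<close> that starts no earlier.

  Splitting off the non-overlined parts divisible by \<open>d\<close> then shows that the moment of the \<open>d\<close>th
  residual crank is \<open>\<Sum>y \<ge> 1. g(y) P(n - d y)\<close>. As \<open>P\<close> is strictly increasing and \<open>g(1) = 1\<close>, this
  is strictly decreasing in \<open>d\<close> as long as \<open>d \<le> n\<close>.
\<close>

subsection \<open>Partitions and conjugation\<close>

definition partitions :: "nat \<Rightarrow> nat list set" where
  "partitions n = {xs. sorted_wrt (\<ge>) xs \<and> (\<forall>x \<in> set xs. 1 \<le> x) \<and> sum_list xs = n}"

text \<open>Rows are indexed from 0 and padded with zeros, so partitions of different lengths can be
  compared as functions.\<close>

definition part :: "nat list \<Rightarrow> nat \<Rightarrow> nat" where
  "part xs i = (if i < length xs then xs ! i else 0)"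

lemma length_le_sum_list:
  fixes xs :: "nat list"
  shows "\<forall>x \<in> set xs. 1 \<le> x \<Longrightarrow> length xs \<le> sum_list xs"
  by (induction xs) auto

lemma finite_partitions: "finite (partitions n)"
proof (rule finite_subset)
  show "partitions n \<subseteq> {xs. set xs \<subseteq> {..n} \<and> length xs \<le> n}"
    unfolding partitions_def using member_le_sum_list length_le_sum_list by auto
  show "finite {xs. set xs \<subseteq> {..n} \<and> length xs \<le> n}"
    by (rule finite_lists_length_le) simp
qed

lemma partitions_0: "partitions 0 = {[]}"
proof -
  have "xs = []" if "xs \<in> partitions 0" for xs
    using that by (cases xs) (auto simp: partitions_def)
  then show ?thesis by (auto simp: partitions_def)
qed

text \<open>In a non-increasing list the parts above \<open>w\<close> form an initial segment. The
  equivalence exchanges row and column indices and underlies both conjugation and the reading of the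
  crank.\<close>

lemma less_length_filter_iff:
  "sorted_wrt (\<ge>) xs \<Longrightarrow> i < length (filter (\<lambda>p. w < p) xs) \<longleftrightarrow> w < part xs i"
proof (induction xs arbitrary: i)
  case Nil
  then show ?case by (simp add: part_def)
next
  case (Cons x xs)
  show ?case
  proof (cases "w < x")
    case True
    then show ?thesis using Cons by (cases i) (auto simp: part_def)
  next
    case False
    then have "filter (\<lambda>p. w < p) (x # xs) = []" using Cons.prems by (auto simp: filter_empty_conv)
    moreover have "part (x # xs) i \<le> x"
      using Cons.prems by (cases i) (auto simp: part_def)
    ultimately show ?thesis using False by simp
  qed
qed

lemma antimono_part: "sorted_wrt (\<ge>) xs \<Longrightarrow> antimono (part xs)"
proof -
  assume s: "sorted_wrt (\<ge>) xs"
  show ?thesis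
    unfolding antimono_iff_le_Suc by (auto simp: part_def intro: sorted_wrt_nth_less[OF s])
qed

text \<open>Since all parts are positive, the padding does not hide the length: it is the first
  index at which \<open>part\<close> vanishes.\<close>

lemma part_eqD:
  assumes "part xs = part ys" "\<forall>x \<in> set xs. 1 \<le> x" "\<forall>x \<in> set ys. 1 \<le> x"
  shows "xs = ys"
proof -
  have *: "length zs = (LEAST i. part zs i = 0)" if "\<forall>x \<in> set zs. 1 \<le> x" for zs
  proof (rule Least_equality[symmetric])
    show "length zs \<le> i" if "part zs i = 0" for i
      using that \<open>\<forall>x \<in> set zs. 1 \<le> x\<close> by (metis nth_mem not_le not_one_le_zero part_def)
  qed (simp add: part_def)
  have len: "length xs = length ys" using assms * by metis
  show ?thesis
  proof (rule nth_equalityI[OF len])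
    fix i assume "i < length xs"
    then show "xs ! i = ys ! i" using fun_cong[OF assms(1), of i] len by (simp add: part_def)
  qed
qed

definition conj_partition :: "nat list \<Rightarrow> nat list" where
  "conj_partition xs = map (\<lambda>i. length (filter (\<lambda>p. i < p) xs)) [0..<part xs 0]"

lemma sum_list_map_if_less:
  fixes N p :: nat
  shows "p \<le> N \<Longrightarrow> (\<Sum>i\<leftarrow>[0..<N]. if i < p then 1 else (0::nat)) = p"
  by (simp add: interv_sum_list_conv_sum_set_nat sum.If_cases atLeast0LessThan Int_absorb1 flip: lessThan_def)

text \<open>Cells of the diagram are counted by columns: a part \<open>x\<close> meets exactly the
  columns \<open>i < x\<close>, all of which lie below \<open>N\<close>.\<close>

lemma sum_list_conj: "\<forall>x\<in>set xs. x \<le> N \<Longrightarrow>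
  sum_list (map (\<lambda>i. length (filter (\<lambda>p. i < p) xs)) [0..<N]) = sum_list xs" for xs :: "nat list"
proof (induction xs)
  case (Cons x xs)
  have "(\<Sum>i\<leftarrow>[0..<N]. length (filter ((<) i) (x # xs))) =
    (\<Sum>i\<leftarrow>[0..<N]. (if i < x then 1 else 0) + length (filter ((<) i) xs))"
    by (intro arg_cong[of _ _ sum_list] map_cong) auto
  then show ?case using Cons sum_list_map_if_less[of x N] by (simp add: sum_list_addf)
qed simp

lemma part_conj_partition:
  assumes "sorted_wrt (\<ge>) xs"
  shows "part (conj_partition xs) i = length (filter (\<lambda>p. i < p) xs)"
proof (cases "i < part xs 0")
  case False
  then have "length (filter (\<lambda>p. i < p) xs) = 0" using less_length_filter_iff[OF assms, of 0 i] by auto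
  then show ?thesis using False by (simp add: part_def conj_partition_def)
qed (simp add: part_def conj_partition_def)

lemma le_part_0: "sorted_wrt (\<ge>) xs \<Longrightarrow> x \<in> set xs \<Longrightarrow> x \<le> part xs 0"
  by (cases xs) (auto simp: part_def)

lemma conj_partition_in_partitions:
  assumes "xs \<in> partitions n"
  shows "conj_partition xs \<in> partitions n"
proof -
  have s: "sorted_wrt (\<ge>) xs" and sum: "sum_list xs = n" using assms by (auto simp: partitions_def)
  have 1: "sum_list (conj_partition xs) = n"
    unfolding conj_partition_def using le_part_0[OF s] sum by (subst sum_list_conj) auto
  have mono: "length (filter (\<lambda>p. j < p) xs) \<le> length (filter (\<lambda>p. i < p) xs)" if "i \<le> j" for i j
    using less_length_filter_iff[OF s, of "length (filter (\<lambda>p. i < p) xs)"] that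
      less_length_filter_iff[OF s, of _ j]
    by (metis le_less_trans less_irrefl not_le)
  have 2: "sorted_wrt (\<ge>) (conj_partition xs)"
    using mono by (auto simp: conj_partition_def sorted_wrt_iff_nth_less)
  have 3: "\<forall>x\<in>set (conj_partition xs). 1 \<le> x"
    using less_length_filter_iff[OF s, of 0] by (auto simp: conj_partition_def Suc_le_eq)
  show ?thesis using 1 2 3 by (simp add: partitions_def)
qed

lemma length_conj_partition: "length (conj_partition xs) = part xs 0"
  by (simp add: conj_partition_def)

lemma part_conj_partition_0:
  assumes "xs \<in> partitions n"
  shows "part (conj_partition xs) 0 = length xs"
proof -
  have "filter (\<lambda>p. 0 < p) xs = xs" using assms by (auto simp: partitions_def filter_id_conv)
  then show ?thesis using assms by (simp add: partitions_def part_conj_partition)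
qed

text \<open>Two uses of \<open>less_length_filter_iff\<close> exchange \<open>w\<close> and
  \<open>i\<close> and then exchange them back; a row length is determined by the numbers
  \<open>w\<close> below it.\<close>

lemma conj_conj_partition:
  assumes "xs \<in> partitions n"
  shows "conj_partition (conj_partition xs) = xs"
proof -
  have s: "sorted_wrt (\<ge>) xs" and s': "sorted_wrt (\<ge>) (conj_partition xs)"
    and pos: "\<forall>x\<in>set xs. 1 \<le> x" "\<forall>x\<in>set (conj_partition (conj_partition xs)). 1 \<le> x"
    using assms conj_partition_in_partitions by (auto simp: partitions_def)
  have "part (conj_partition (conj_partition xs)) i = part xs i" for i
  proof -
    have "w < part (conj_partition (conj_partition xs)) i \<longleftrightarrow> w < part xs i" for w
      using part_conj_partition[OF s'] part_conj_partition[OF s] less_length_filter_iff[OF s]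
        less_length_filter_iff[OF s'] by metis
    then show ?thesis by (metis less_irrefl linorder_neqE_nat)
  qed
  then show ?thesis using pos by (intro part_eqD) auto
qed

lemma card_length_eq_card_part_0:
  "card {xs \<in> partitions n. m \<le> length xs} = card {xs \<in> partitions n. m \<le> part xs 0}"
  by (rule bij_betw_same_card[of conj_partition], rule bij_betw_byWitness[where f' = conj_partition])
    (auto simp: conj_conj_partition conj_partition_in_partitions length_conj_partition part_conj_partition_0)

subsection \<open>Durfee rectangles\<close>

text \<open>Young diagrams as functions from row index to row length. Inserting or deleting a row is
  then a mere shift of indices.\<close>

definition diagrams :: "(nat \<Rightarrow> nat) set" where
  "diagrams = {f. antimono f \<and> (\<exists>N. \<forall>i\<ge>N. f i = 0)}"

definition weight :: "(nat \<Rightarrow> nat) \<Rightarrow> nat" where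
  "weight f = sum f {i. f i \<noteq> 0}"

text \<open>The width \<open>D\<close> of the largest rectangle with \<open>D\<close> columns and
  \<open>D + e\<close> rows inside the diagram; \<open>e = 0\<close> gives the Durfee
  square.\<close>

definition durfee :: "nat \<Rightarrow> (nat \<Rightarrow> nat) \<Rightarrow> nat" where
  "durfee e f = (LEAST w. f (w + e) \<le> w)"

lemma weight_eq_sum:
  assumes "\<And>i. N \<le> i \<Longrightarrow> f i = 0"
  shows "weight f = sum f {..<N}"
proof -
  have "{i. f i \<noteq> 0} \<subseteq> {..<N}"
  proof
    fix i assume "i \<in> {i. f i \<noteq> 0}"
    then show "i \<in> {..<N}" using assms[of i] by (cases "N \<le> i") auto
  qed
  then show ?thesis unfolding weight_def by (intro sum.mono_neutral_left) auto
qed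

text \<open>As \<open>w\<close> grows, \<open>f (w + e)\<close> cannot increase, so the condition
  \<open>w < f (w + e)\<close> holds up to a threshold and fails from there on.\<close>

lemma less_durfee_iff:
  assumes "f \<in> diagrams"
  shows "w < durfee e f \<longleftrightarrow> w < f (w + e)"
proof -
  obtain N where "\<forall>i\<ge>N. f i = 0" using assms by (auto simp: diagrams_def)
  then have "f (N + e) \<le> N" by simp
  then have *: "f (durfee e f + e) \<le> durfee e f" unfolding durfee_def by (rule LeastI)
  have anti: "f j \<le> f i" if "i \<le> j" for i j
    using assms that by (auto simp: diagrams_def antimono_def)
  have "w < f (w + e)" if "w < durfee e f"
    using not_less_Least that unfolding durfee_def by fastforce
  moreover have "\<not> w < f (w + e)" if "durfee e f \<le> w"
    using anti[of "durfee e f + e" "w + e"] * that by linarith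
  ultimately show ?thesis by (meson not_le)
qed

text \<open>The last assumption says that the rectangle of width \<open>D\<close> fits, the middle
  one that width \<open>D + 1\<close> does not.\<close>

lemma durfee_eqI:
  assumes "f \<in> diagrams" "f (D + e) \<le> D" "D = 0 \<or> D \<le> f (D - 1 + e)"
  shows "durfee e f = D"
proof -
  have "\<not> D < durfee e f" using assms less_durfee_iff by (simp add: not_less)
  moreover have "D = 0 \<or> D - 1 < durfee e f" using assms less_durfee_iff by auto
  ultimately show ?thesis by linarith
qed

lemma durfee_bounds:
  assumes "f \<in> diagrams"
  shows "f (durfee e f + e) \<le> durfee e f" and "durfee e f = 0 \<or> durfee e f \<le> f (durfee e f - 1 + e)"
  using less_durfee_iff[OF assms, of "durfee e f" e] less_durfee_iff[OF assms, of "durfee e f - 1" e]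
  by auto

section \<open>Inserting and deleting rows and columns of a diagram\<close>

definition insert_part :: "nat \<Rightarrow> nat \<Rightarrow> (nat \<Rightarrow> nat) \<Rightarrow> nat \<Rightarrow> nat" where
  "insert_part i d f j = (if j < i then f j else if j = i then d else f (j - 1))"

definition delete_part :: "nat \<Rightarrow> (nat \<Rightarrow> nat) \<Rightarrow> nat \<Rightarrow> nat" where
  "delete_part i f j = (if j < i then f j else f (Suc j))"

definition add_column :: "nat \<Rightarrow> (nat \<Rightarrow> nat) \<Rightarrow> nat \<Rightarrow> nat" where
  "add_column h f j = (if j < h then Suc (f j) else f j)"

definition remove_column :: "nat \<Rightarrow> (nat \<Rightarrow> nat) \<Rightarrow> nat \<Rightarrow> nat" where
  "remove_column h f j = (if j < h then f j - 1 else f j)"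

lemma weight_insert_part:
  assumes "f \<in> diagrams"
  shows "weight (insert_part i d f) = weight f + d"
proof -
  obtain N0 where N0: "\<forall>i\<ge>N0. f i = 0" using assms by (auto simp: diagrams_def)
  define N where "N = max N0 i"
  have *: "sum (insert_part i d f) {..<Suc n} = sum f {..<n} + d" if "i \<le> n" for n
    using that by (induction n rule: dec_induct) (auto simp: insert_part_def)
  have "weight (insert_part i d f) = sum (insert_part i d f) {..<Suc N}"
    using N0 by (intro weight_eq_sum) (auto simp: N_def insert_part_def)
  also have "\<dots> = sum f {..<N} + d" by (rule *) (simp add: N_def)
  also have "sum f {..<N} = weight f" using N0 by (intro weight_eq_sum[symmetric]) (auto simp: N_def)
  finally show ?thesis .
qed

lemma weight_add_column:
  assumes "f \<in> diagrams"
  shows "weight (add_column h f) = weight f + h"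
proof -
  obtain N0 where N0: "\<forall>i\<ge>N0. f i = 0" using assms by (auto simp: diagrams_def)
  define N where "N = max N0 h"
  have "weight (add_column h f) = sum (add_column h f) {..<N}"
    using N0 by (intro weight_eq_sum) (auto simp: N_def add_column_def)
  also have "\<dots> = (\<Sum>j<N. f j + (if j < h then 1 else 0))"
    by (intro sum.cong) (auto simp: add_column_def)
  also have "\<dots> = sum f {..<N} + card {j. j < N \<and> j < h}"
    by (simp add: sum.distrib sum.If_cases Int_def)
  also have "{j. j < N \<and> j < h} = {..<h}" by (auto simp: N_def)
  also have "sum f {..<N} = weight f" using N0 by (intro weight_eq_sum[symmetric]) (auto simp: N_def)
  finally show ?thesis by simp
qed

lemma insert_delete_part: "f i = d \<Longrightarrow> insert_part i d (delete_part i f) = f"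
  by (rule ext) (auto simp: insert_part_def delete_part_def)

lemma delete_insert_part: "delete_part i (insert_part i d f) = f"
  by (rule ext) (auto simp: insert_part_def delete_part_def)

lemma remove_add_column: "remove_column h (add_column h f) = f"
  by (rule ext) (auto simp: remove_column_def add_column_def)

lemma add_remove_column: "(\<And>j. j < h \<Longrightarrow> 0 < f j) \<Longrightarrow> add_column h (remove_column h f) = f"
  by (rule ext) (auto simp: remove_column_def add_column_def)

lemma insert_part_in_diagrams:
  assumes "f \<in> diagrams" "f i \<le> d" "i = 0 \<or> d \<le> f (i - 1)"
  shows "insert_part i d f \<in> diagrams"
proof -
  obtain N where N: "\<forall>i\<ge>N. f i = 0" using assms by (auto simp: diagrams_def)
  have f: "\<And>j. f (Suc j) \<le> f j" using assms by (auto simp: diagrams_def antimono_iff_le_Suc)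
  have "insert_part i d f (Suc j) \<le> insert_part i d f j" for j
  proof (cases "j < i")
    case True
    then have "Suc j < i \<or> i = Suc j" by linarith
    then show ?thesis using f[of j] assms(3) True by (auto simp: insert_part_def)
  next
    case False
    then show ?thesis using f[of "j - 1"] assms(2) by (auto simp: insert_part_def)
  qed
  moreover have "\<forall>j\<ge>Suc (max N i). insert_part i d f j = 0" using N by (auto simp: insert_part_def)
  ultimately show ?thesis unfolding diagrams_def antimono_iff_le_Suc by blast
qed

lemma delete_part_in_diagrams:
  assumes "f \<in> diagrams"
  shows "delete_part i f \<in> diagrams"
proof -
  obtain N where N: "\<forall>i\<ge>N. f i = 0" using assms by (auto simp: diagrams_def)
  have f: "\<And>j. f (Suc j) \<le> f j" using assms by (auto simp: diagrams_def antimono_iff_le_Suc)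
  have "delete_part i f (Suc j) \<le> delete_part i f j" for j
    using f[of j] f[of "Suc j"] by (auto simp: delete_part_def)
  moreover have "\<forall>j\<ge>N. delete_part i f j = 0" using N by (auto simp: delete_part_def)
  ultimately show ?thesis unfolding diagrams_def antimono_iff_le_Suc by blast
qed

lemma add_column_in_diagrams:
  assumes "f \<in> diagrams"
  shows "add_column h f \<in> diagrams"
proof -
  obtain N where N: "\<forall>i\<ge>N. f i = 0" using assms by (auto simp: diagrams_def)
  have f: "\<And>j. f (Suc j) \<le> f j" using assms by (auto simp: diagrams_def antimono_iff_le_Suc)
  have "add_column h f (Suc j) \<le> add_column h f j" for j
    using f[of j] by (auto simp: add_column_def)
  moreover have "\<forall>j\<ge>max N h. add_column h f j = 0" using N by (auto simp: add_column_def)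
  ultimately show ?thesis unfolding diagrams_def antimono_iff_le_Suc by blast
qed

lemma remove_column_in_diagrams:
  assumes "f \<in> diagrams" "h = 0 \<or> f h < f (h - 1)"
  shows "remove_column h f \<in> diagrams"
proof -
  obtain N where N: "\<forall>i\<ge>N. f i = 0" using assms by (auto simp: diagrams_def)
  have f: "\<And>j. f (Suc j) \<le> f j" using assms by (auto simp: diagrams_def antimono_iff_le_Suc)
  have "remove_column h f (Suc j) \<le> remove_column h f j" for j
  proof (cases "Suc j = h")
    case True
    then show ?thesis using assms(2) by (auto simp: remove_column_def)
  next
    case False
    then show ?thesis using f[of j] by (auto simp: remove_column_def)
  qed
  moreover have "\<forall>j\<ge>N. remove_column h f j = 0" using N by (auto simp: remove_column_def)
  ultimately show ?thesis unfolding diagrams_def antimono_iff_le_Suc by blast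
qed

text \<open>The complement of a crank condition: this set turns out to be equinumerous with the
  partitions of \<open>s\<close> whose \<open>crank1\<close> is at most \<open>e\<close>.\<close>

definition durfee_sum :: "nat \<Rightarrow> nat \<Rightarrow> (nat \<Rightarrow> nat) set" where
  "durfee_sum e s = {f \<in> diagrams. weight f + durfee e f = s}"

text \<open>The new row goes directly below the rectangle of \<open>D + e\<close> rows and
  \<open>D\<close> columns, where \<open>f (D + e) \<le> D\<close> leaves room for it. The rectangle
  gains one row and keeps its width.\<close>

lemma durfee_insert_part:
  fixes e f
  defines "D \<equiv> durfee e f"
  assumes f: "f \<in> diagrams"
  shows "insert_part (D + e) D f \<in> diagrams" and "durfee (Suc e) (insert_part (D + e) D f) = D"
proof -
  note b = durfee_bounds[OF f, of e, folded D_def]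
  have "D + e = 0 \<or> D \<le> f (D + e - 1)" using b(2) by (cases D) auto
  then show 1: "insert_part (D + e) D f \<in> diagrams" by (intro insert_part_in_diagrams f b)
  show "durfee (Suc e) (insert_part (D + e) D f) = D"
    using b by (intro durfee_eqI 1) (auto simp: insert_part_def)
qed

text \<open>Row \<open>D + e\<close> is the last row of the rectangle. The rows above it still have
  length at least \<open>D\<close>, and the row moving up into its place has length at most
  \<open>D\<close>.\<close>

lemma durfee_delete_part:
  fixes e f
  defines "D \<equiv> durfee (Suc e) f"
  assumes f: "f \<in> diagrams" and eq: "f (D + e) = D"
  shows "durfee e (delete_part (D + e) f) = D"
proof (rule durfee_eqI[OF delete_part_in_diagrams[OF f]])
  have "antimono f" using f by (simp add: diagrams_def)
  then have "f (D + e) \<le> f (D - 1 + e)" by (simp add: antimonoD)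
  then show "D = 0 \<or> D \<le> delete_part (D + e) f (D - 1 + e)" using eq by (auto simp: delete_part_def)
qed (use durfee_bounds[OF f, of "Suc e", folded D_def] in \<open>auto simp: delete_part_def\<close>)

text \<open>The column lengthens exactly the rows of the rectangle; the row below, which bounds its
  width, is untouched.\<close>

lemma durfee_add_column:
  fixes e f
  defines "D \<equiv> durfee (Suc e) f"
  assumes f: "f \<in> diagrams"
  shows "durfee (Suc e) (add_column (Suc (D + e)) f) = D"
  using durfee_bounds[OF f, of "Suc e", folded D_def]
  by (intro durfee_eqI add_column_in_diagrams f) (auto simp: add_column_def)

text \<open>Since \<open>f (D + Suc e) \<le> D < f (D + e)\<close>, there is a strict drop below row
  \<open>D + e\<close>. Shortening the rows down to it therefore keeps the order and leaves them at
  least \<open>D\<close> long.\<close>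

lemma durfee_remove_column:
  fixes e f
  defines "D \<equiv> durfee (Suc e) f"
  assumes f: "f \<in> diagrams" and less: "D < f (D + e)"
  shows "remove_column (Suc (D + e)) f \<in> diagrams"
    and "durfee (Suc e) (remove_column (Suc (D + e)) f) = D"
    and "add_column (Suc (D + e)) (remove_column (Suc (D + e)) f) = f"
proof -
  note b = durfee_bounds[OF f, of "Suc e", folded D_def]
  show 1: "remove_column (Suc (D + e)) f \<in> diagrams"
    using b less by (intro remove_column_in_diagrams f) auto
  show "durfee (Suc e) (remove_column (Suc (D + e)) f) = D"
    using b less by (intro durfee_eqI 1) (auto simp: remove_column_def)
  have "0 < f j" if "j < Suc (D + e)" for j
  proof -
    have "f (D + e) \<le> f j" using f that by (auto simp: diagrams_def antimono_def)
    then show ?thesis using less by linarith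
  qed
  then show "add_column (Suc (D + e)) (remove_column (Suc (D + e)) f) = f"
    by (rule add_remove_column)
qed

text \<open>Row \<open>D + e\<close> of a diagram with \<open>D = durfee (Suc e) f\<close> has length at least \<open>D\<close>. If the length
  is exactly \<open>D\<close>, that row can be deleted; if it is larger, a column of height \<open>D + e + 1\<close> can be.\<close>

lemma durfee_sum_bij1:
  "bij_betw (\<lambda>f. insert_part (durfee e f + e) (durfee e f) f) (durfee_sum e s)
     {f \<in> diagrams. weight f = s \<and> f (durfee (Suc e) f + e) = durfee (Suc e) f}"
proof (rule bij_betw_byWitness[where f' = "\<lambda>f. delete_part (durfee (Suc e) f + e) f"], goal_cases)
  case 1
  then show ?case by (auto simp: durfee_sum_def durfee_insert_part delete_insert_part)
next
  case 2
  then show ?case by (auto simp: durfee_delete_part insert_delete_part)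
next
  case 3
  then show ?case by (auto simp: durfee_sum_def durfee_insert_part weight_insert_part)
    (simp add: insert_part_def)
next
  case 4
  have "weight (delete_part (durfee (Suc e) f + e) f) + durfee (Suc e) f = weight f"
    if "f \<in> diagrams" "f (durfee (Suc e) f + e) = durfee (Suc e) f" for f
  proof -
    have "insert_part (durfee (Suc e) f + e) (durfee (Suc e) f) (delete_part (durfee (Suc e) f + e) f) = f"
      by (rule insert_delete_part) (rule that(2))
    then show ?thesis
      using weight_insert_part[OF delete_part_in_diagrams[OF that(1), of "durfee (Suc e) f + e"],
          of "durfee (Suc e) f + e" "durfee (Suc e) f"] by (simp only:)
  qed
  then show ?case by (auto simp: durfee_sum_def durfee_delete_part delete_part_in_diagrams)
qed

text \<open>The weight \<open>s - D\<close> grows by the column height \<open>D + Suc e\<close>, so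
  the total \<open>s + Suc e\<close> does not depend on \<open>D\<close>.\<close>

lemma durfee_sum_bij2:
  "bij_betw (\<lambda>f. add_column (Suc (durfee (Suc e) f + e)) f) (durfee_sum (Suc e) s)
     {f \<in> diagrams. weight f = s + Suc e \<and> durfee (Suc e) f < f (durfee (Suc e) f + e)}"
proof (rule bij_betw_byWitness[where f' = "\<lambda>f. remove_column (Suc (durfee (Suc e) f + e)) f"], goal_cases)
  case 1
  then show ?case by (auto simp: durfee_sum_def durfee_add_column remove_add_column)
next
  case 2
  then show ?case by (auto simp: durfee_remove_column)
next
  case 3
  have "durfee (Suc e) f < add_column (Suc (durfee (Suc e) f + e)) f (durfee (Suc e) f + e)"
    if "f \<in> diagrams" for f
    using durfee_bounds(2)[OF that, of "Suc e"] by (cases "durfee (Suc e) f") (auto simp: add_column_def)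
  then show ?case
    by (auto simp: durfee_sum_def durfee_add_column weight_add_column add_column_in_diagrams)
next
  case 4
  have *: "weight (remove_column (Suc (durfee (Suc e) f + e)) f) + Suc (durfee (Suc e) f + e) = weight f"
    if "f \<in> diagrams" "durfee (Suc e) f < f (durfee (Suc e) f + e)" for f
    using weight_add_column[OF durfee_remove_column(1)[OF that], of "Suc (durfee (Suc e) f + e)"]
      durfee_remove_column(3)[OF that] by (simp only:)
  then have "weight (remove_column (Suc (durfee (Suc e) f + e)) f) + durfee (Suc e) f = s"
    if "f \<in> diagrams" "durfee (Suc e) f < f (durfee (Suc e) f + e)" "weight f = s + Suc e" for f
    using *[OF that(1,2)] that(3) by linarith
  then show ?case by (auto simp: durfee_sum_def durfee_remove_column)
qed

subsection \<open>Partitions by crank\<close>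

lemma part_in_diagrams:
  assumes "xs \<in> partitions n"
  shows "part xs \<in> diagrams" and "weight (part xs) = n"
proof -
  show "part xs \<in> diagrams" using assms antimono_part unfolding diagrams_def partitions_def
    by (auto simp: part_def intro!: exI[of _ "length xs"])
  have "weight (part xs) = sum (part xs) {..<length xs}" by (rule weight_eq_sum) (simp add: part_def)
  also have "\<dots> = sum_list xs" by (simp add: sum_list_sum_nth part_def atLeast0LessThan)
  finally show "weight (part xs) = n" using assms by (simp add: partitions_def)
qed

lemma bij_betw_part: "bij_betw part (partitions n) {f \<in> diagrams. weight f = n}"
  unfolding bij_betw_def
proof
  show "inj_on part (partitions n)" by (intro inj_onI part_eqD) (auto simp: partitions_def)
  show "part ` partitions n = {f \<in> diagrams. weight f = n}"
  proof (intro equalityI subsetI)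
    fix f assume "f \<in> {f \<in> diagrams. weight f = n}"
    then have f: "f \<in> diagrams" and n: "weight f = n" by auto
    obtain N where N: "\<forall>i\<ge>N. f i = 0" using f by (auto simp: diagrams_def)
    define L where "L = (LEAST i. f i = 0)"
    have anti: "f j \<le> f i" if "i \<le> j" for i j using f that by (auto simp: diagrams_def antimono_def)
    have "f L = 0" unfolding L_def by (rule LeastI[of _ N]) (simp add: N)
    then have 0: "f i = 0" if "L \<le> i" for i using anti[OF that] by simp
    have pos: "f i \<noteq> 0" if "i < L" for i using that not_less_Least unfolding L_def by blast
    have p: "part (map f [0..<L]) = f" by (rule ext) (auto simp: part_def 0)
    have 1: "sorted_wrt (\<ge>) (map f [0..<L])" by (auto simp: sorted_wrt_iff_nth_less anti)
    have 2: "\<forall>x\<in>set (map f [0..<L]). 1 \<le> x" using pos by (auto simp: Suc_le_eq)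
    have "weight f = sum f {..<L}" by (rule weight_eq_sum) (rule 0)
    then have "sum_list (map f [0..<L]) = n" using n by (simp add: interv_sum_list_conv_sum_set_nat atLeast0LessThan)
    then have "map f [0..<L] \<in> partitions n" using 1 2 by (simp add: partitions_def)
    then show "f \<in> part ` partitions n" using p by (metis imageI)
  qed (auto simp: part_in_diagrams)
qed

lemma finite_weight: "finite {f \<in> diagrams. weight f = n}"
  using bij_betw_finite[OF bij_betw_part] finite_partitions by blast

lemma card_durfee_sum:
  "card (durfee_sum e s) = (\<Sum>n\<le>s. card {xs \<in> partitions n. n + durfee e (part xs) = s})"
proof -
  have "durfee_sum e s = (\<Union>n\<in>{..s}. part ` {xs \<in> partitions n. n + durfee e (part xs) = s})"
    (is "_ = (\<Union>n\<in>_. ?A n)")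
  proof (intro equalityI subsetI)
    fix f assume f: "f \<in> durfee_sum e s"
    then have "f \<in> part ` partitions (weight f)"
      using bij_betw_imp_surj_on[OF bij_betw_part] by (auto simp: durfee_sum_def)
    then show "f \<in> (\<Union>n\<in>{..s}. ?A n)" using f by (auto simp: durfee_sum_def)
  qed (auto simp: durfee_sum_def part_in_diagrams)
  also have "card \<dots> = (\<Sum>n\<le>s. card (?A n))"
  proof (rule card_UN_disjoint)
    show "\<forall>i\<in>{..s}. finite (?A i)" by (simp add: finite_partitions)
    show "\<forall>i\<in>{..s}. \<forall>j\<in>{..s}. i \<noteq> j \<longrightarrow> ?A i \<inter> ?A j = {}"
      using part_in_diagrams(2) by fastforce
  qed simp
  also have "\<dots> = (\<Sum>n\<le>s. card {xs \<in> partitions n. n + durfee e (part xs) = s})"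
    using bij_betw_imp_inj_on[OF bij_betw_part] by (intro sum.cong card_image refl) (auto simp: inj_on_def)
  finally show ?thesis .
qed

text \<open>The diagrams of weight \<open>s + Suc e\<close> split according to whether row
  \<open>D + e\<close>, with \<open>D = durfee (Suc e) f\<close>, has length exactly
  \<open>D\<close> or more; the two bijections count the two classes.\<close>

lemma durfee_sum_recurrence:
  "card (partitions (s + Suc e)) = card (durfee_sum e (s + Suc e)) + card (durfee_sum (Suc e) s)"
proof -
  let ?D = "durfee (Suc e)"
  let ?X = "{f \<in> diagrams. weight f = s + Suc e \<and> f (?D f + e) = ?D f}"
  let ?Y = "{f \<in> diagrams. weight f = s + Suc e \<and> ?D f < f (?D f + e)}"
  have le: "?D f \<le> f (?D f + e)" if "f \<in> diagrams" for f
    using durfee_bounds(2)[OF that, of "Suc e"] by (cases "?D f") auto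
  have eq: "{f \<in> diagrams. weight f = s + Suc e} = ?X \<union> ?Y"
    by (auto simp: not_less intro: antisym le)
  have "card (partitions (s + Suc e)) = card {f \<in> diagrams. weight f = s + Suc e}"
    by (rule bij_betw_same_card[OF bij_betw_part])
  also have "\<dots> = card ?X + card ?Y"
    unfolding eq by (rule card_Un_disjoint) (auto intro: finite_subset[OF _ finite_weight])
  finally show ?thesis
    using bij_betw_same_card[OF durfee_sum_bij1] bij_betw_same_card[OF durfee_sum_bij2] by simp
qed

text \<open>A rectangle of positive width needs at least \<open>Suc e\<close> nonempty rows, hence
  weight at least \<open>Suc e\<close>. Below that bound the Durfee term is 0.\<close>

lemma durfee_sum_small:
  assumes "s < Suc e"
  shows "card (durfee_sum e s) = card (partitions s)"
proof -
  have "durfee e f = 0" if "f \<in> diagrams" "weight f \<le> s" for f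
  proof (rule ccontr)
    assume "durfee e f \<noteq> 0"
    then have "0 < f e" using less_durfee_iff[OF that(1), of 0 e] by simp
    then have pos: "1 \<le> f i" if "i < Suc e" for i
      using \<open>f \<in> diagrams\<close> that by (auto simp: diagrams_def antimono_def Suc_le_eq intro: less_le_trans)
    obtain N where N: "\<forall>i\<ge>N. f i = 0" using \<open>f \<in> diagrams\<close> by (auto simp: diagrams_def)
    have "Suc e = (\<Sum>i<Suc e. 1)" by simp
    also have "\<dots> \<le> sum f {..<Suc e}" using pos by (intro sum_mono) auto
    also have "\<dots> \<le> sum f {..<max N (Suc e)}" by (intro sum_mono2) auto
    also have "\<dots> = weight f" using N by (intro weight_eq_sum[symmetric]) auto
    finally show False using assms that by simp
  qed
  then have "durfee_sum e s = {f \<in> diagrams. weight f = s}"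
    unfolding durfee_sum_def by (metis (mono_tags, lifting) Nat.add_0_right le_add1)
  then show ?thesis using bij_betw_same_card[OF bij_betw_part] by metis
qed

text \<open>For \<open>m \<ge> 1\<close> the Andrews--Garvan weights treat \<open>(1)\<close> as a partition of crank 1.\<close>

definition crank1 :: "nat list \<Rightarrow> int" where
  "crank1 \<mu> = (if \<mu> = [1] then 1 else crank \<mu>)"

lemma less_crank1_iff:
  assumes "\<mu> \<in> partitions s"
  shows "int e < crank1 \<mu> \<longleftrightarrow> \<mu> = [1] \<and> e = 0 \<or>
    ones \<mu> = 0 \<and> e < part \<mu> 0 \<or> ones \<mu> \<noteq> 0 \<and> ones \<mu> < part \<mu> (ones \<mu> + e)"
proof -
  have s: "sorted_wrt (\<ge>) \<mu>" using assms by (simp add: partitions_def)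
  have "Max (set \<mu>) = part \<mu> 0" if "\<mu> \<noteq> []"
    using that le_part_0[OF s] by (intro Max_eqI) (auto simp: part_def)
  \<comment> \<open>The difference exceeds \<open>e\<close> exactly when index
    \<open>ones \<mu> + e\<close> still lies in the initial segment of parts above
    \<open>ones \<mu>\<close>.\<close>
  moreover have "int e < int (length (filter (\<lambda>p. p > ones \<mu>) \<mu>)) - int (ones \<mu>) \<longleftrightarrow>
    ones \<mu> < part \<mu> (ones \<mu> + e)"
    unfolding less_length_filter_iff[OF s, symmetric] by linarith
  moreover have "part [] 0 = 0" "ones [1] = 1" "part [1] (Suc e) = 0" by (simp_all add: part_def ones_def)
  ultimately show ?thesis by (auto simp: crank1_def crank_def)
qed

section \<open>Adding and removing parts equal to 1\<close>

lemma split_ones: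
  "sorted_wrt (\<ge>) \<mu> \<Longrightarrow> \<forall>x\<in>set \<mu>. 1 \<le> x \<Longrightarrow> \<mu> = filter (\<lambda>p. p \<noteq> 1) \<mu> @ replicate (ones \<mu>) 1"
proof (induction \<mu>)
  case (Cons x \<mu>)
  show ?case
  proof (cases "x = 1")
    case True
    then have "\<forall>y\<in>set \<mu>. y = 1" using Cons.prems by (auto intro: antisym)
    then have "filter (\<lambda>p. p \<noteq> 1) \<mu> = []" by (auto simp: filter_empty_conv)
    then show ?thesis using Cons True by (simp add: ones_def)
  qed (use Cons in \<open>simp add: ones_def\<close>)
qed (simp add: ones_def)

lemma ones_append: "ones (xs @ ys) = ones xs + ones ys"
  by (simp add: ones_def)

lemma ones_replicate: "ones (replicate w 1) = w"
  by (simp add: ones_def)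

lemma append_ones_in_partitions:
  "xs @ replicate w 1 \<in> partitions (n + w) \<longleftrightarrow> xs \<in> partitions n"
proof -
  have "sorted_wrt (\<ge>) (replicate w (1::nat))" by (induction w) auto
  then show ?thesis by (auto simp: partitions_def sorted_wrt_append sum_list_replicate)
qed

lemma part_append_ones: "0 < w \<Longrightarrow> w < part (xs @ replicate v 1) i \<longleftrightarrow> w < part xs i"
  by (auto simp: part_def nth_append)

lemma partitions_with_one:
  assumes "\<mu> \<in> partitions (Suc n)" "ones \<mu> \<noteq> 0"
  obtains \<pi> where "\<pi> \<in> partitions n" "\<mu> = \<pi> @ [1]"
proof -
  obtain v where v: "ones \<mu> = Suc v" using assms(2) not0_implies_Suc by blast
  have "\<mu> = (filter (\<lambda>p. p \<noteq> 1) \<mu> @ replicate v 1) @ [1]"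
    using split_ones[of \<mu>] assms(1) v by (simp add: partitions_def replicate_append_same)
  moreover from this have "filter (\<lambda>p. p \<noteq> 1) \<mu> @ replicate v 1 \<in> partitions n"
    using append_ones_in_partitions[of _ 1 n] assms(1) by (metis One_nat_def Suc_eq_plus1 replicate_0 replicate_Suc)
  ultimately show thesis using that by blast
qed

lemma card_with_one:
  assumes "\<And>\<pi>. \<pi> \<in> partitions n \<Longrightarrow> P (\<pi> @ [1]) \<longleftrightarrow> Q \<pi>"
  shows "card {\<mu> \<in> partitions (Suc n). ones \<mu> \<noteq> 0 \<and> P \<mu>} = card {\<pi> \<in> partitions n. Q \<pi>}"
proof (rule bij_betw_same_card[symmetric], unfold bij_betw_def, intro conjI)
  show "inj_on (\<lambda>\<pi>. \<pi> @ [1]) {\<pi> \<in> partitions n. Q \<pi>}" by (simp add: inj_on_def)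
  have in1: "\<pi> @ [1] \<in> partitions (Suc n)" if "\<pi> \<in> partitions n" for \<pi>
    using append_ones_in_partitions[of \<pi> 1 n] that by simp
  show "(\<lambda>\<pi>. \<pi> @ [1]) ` {\<pi> \<in> partitions n. Q \<pi>} = {\<mu> \<in> partitions (Suc n). ones \<mu> \<noteq> 0 \<and> P \<mu>}"
    using assms in1 by (auto elim!: partitions_with_one simp: ones_def)
qed

lemma card_split_ones:
  "card {\<mu> \<in> partitions n. P \<mu>} =
    card {\<mu> \<in> partitions n. ones \<mu> = 0 \<and> P \<mu>} + card {\<mu> \<in> partitions n. ones \<mu> \<noteq> 0 \<and> P \<mu>}"
  by (subst card_Un_disjoint[symmetric])
    (auto intro: finite_subset[OF _ finite_partitions] arg_cong[of _ _ card])

text \<open>All \<open>w\<close> ones are stripped or appended at once. Rows longer than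
  \<open>w\<close> are not affected, because \<open>w\<close> is at least 1.\<close>

lemma card_ones_eq:
  assumes "0 < w"
  shows "card {\<mu> \<in> partitions (n + w). ones \<mu> = w \<and> w < part \<mu> i} =
    card {\<pi> \<in> partitions n. ones \<pi> = 0 \<and> w < part \<pi> i}"
proof (rule bij_betw_same_card[symmetric], rule bij_betw_byWitness[where f' = "filter (\<lambda>p. p \<noteq> 1)"])
  have *: "filter (\<lambda>p. p \<noteq> 1) (\<pi> @ replicate w 1) = \<pi>" if "ones \<pi> = 0" for \<pi>
    using that by (auto simp: ones_def filter_id_conv filter_empty_conv)
  then show "\<forall>\<pi>\<in>{\<pi> \<in> partitions n. ones \<pi> = 0 \<and> w < part \<pi> i}.
    filter (\<lambda>p. p \<noteq> 1) (\<pi> @ replicate w 1) = \<pi>" by blast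
  have **: "\<mu> = filter (\<lambda>p. p \<noteq> 1) \<mu> @ replicate w 1"
    if "\<mu> \<in> partitions (n + w)" "ones \<mu> = w" for \<mu>
    using split_ones[of \<mu>] that by (simp add: partitions_def)
  then show "\<forall>\<mu>\<in>{\<mu> \<in> partitions (n + w). ones \<mu> = w \<and> w < part \<mu> i}.
    filter (\<lambda>p. p \<noteq> 1) \<mu> @ replicate w 1 = \<mu>" by auto
  show "(\<lambda>\<pi>. \<pi> @ replicate w 1) ` {\<pi> \<in> partitions n. ones \<pi> = 0 \<and> w < part \<pi> i}
    \<subseteq> {\<mu> \<in> partitions (n + w). ones \<mu> = w \<and> w < part \<mu> i}"
    using assms by (auto simp del: One_nat_def
        simp: append_ones_in_partitions ones_append ones_replicate part_append_ones)
  have "filter (\<lambda>p. p \<noteq> 1) \<mu> \<in> partitions n \<and> w < part (filter (\<lambda>p. p \<noteq> 1) \<mu>) i"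
    if "\<mu> \<in> partitions (n + w)" "ones \<mu> = w" "w < part \<mu> i" for \<mu>
    using **[OF that(1,2)] that append_ones_in_partitions part_append_ones assms by metis
  then show "filter (\<lambda>p. p \<noteq> 1) ` {\<mu> \<in> partitions (n + w). ones \<mu> = w \<and> w < part \<mu> i}
    \<subseteq> {\<pi> \<in> partitions n. ones \<pi> = 0 \<and> w < part \<pi> i}"
    by (auto simp: ones_def filter_empty_conv)
qed

text \<open>\<open>frame_sum e s\<close> counts the pairs \<open>(w, \<pi>)\<close> with \<open>w + |\<pi>| = s\<close> and \<open>w < \<pi>(w + e)\<close>, that is,
  \<open>w < durfee e \<pi>\<close>. Its increments can be read in two ways: removing a part 1 from \<open>\<pi>\<close> leaves the
  partitions of crank above \<open>e\<close>, while summing over \<open>w\<close> first leaves the partitions of \<open>s\<close>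
  minus those with \<open>|\<pi>| + durfee e \<pi> = s\<close>.\<close>

definition frame_count :: "nat \<Rightarrow> nat \<Rightarrow> nat \<Rightarrow> nat" where
  "frame_count e w n = card {\<pi> \<in> partitions n. w < part \<pi> (w + e)}"

definition frame_sum :: "nat \<Rightarrow> nat \<Rightarrow> nat" where
  "frame_sum e s = (\<Sum>w\<le>s. frame_count e w (s - w))"

lemma frame_count_0: "frame_count e w 0 = 0"
proof -
  have "{\<pi> \<in> partitions 0. w < part \<pi> (w + e)} = {}" by (auto simp: partitions_0 part_def)
  then show ?thesis by (simp only: frame_count_def card.empty)
qed

text \<open>Partitions of \<open>Suc n\<close> containing a 1 lose one such part and are counted by
  \<open>frame_count e w n\<close>. Those without ones receive \<open>w\<close> ones and become the
  partitions with exactly \<open>w\<close> ones and crank above \<open>e\<close>.\<close>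

lemma frame_count_Suc:
  assumes "0 < w"
  shows "frame_count e w (Suc n) = frame_count e w n +
    card {\<mu> \<in> partitions (Suc n + w). ones \<mu> = w \<and> w < part \<mu> (w + e)}"
  unfolding card_ones_eq[OF assms] frame_count_def
  using card_split_ones[of "Suc n" "\<lambda>\<mu>. w < part \<mu> (w + e)"]
    card_with_one[of n "\<lambda>\<mu>. w < part \<mu> (w + e)" "\<lambda>\<mu>. w < part \<mu> (w + e)"]
    part_append_ones[OF assms, of _ 1] by simp

text \<open>For \<open>w = 0\<close> the condition says that there are more than \<open>e\<close>
  parts; conjugation turns this into a largest part above \<open>e\<close>, as the crank of a
  partition without ones requires.\<close>

lemma frame_count_0_eq: "frame_count e 0 n = card {\<pi> \<in> partitions n. e < part \<pi> 0}"
proof -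
  have "0 < part \<pi> e \<longleftrightarrow> Suc e \<le> length \<pi>" if "\<pi> \<in> partitions n" for \<pi>
    using that by (auto simp: partitions_def part_def Suc_le_eq dest: nth_mem)
  then have "{\<pi> \<in> partitions n. 0 < part \<pi> (0 + e)} = {\<pi> \<in> partitions n. Suc e \<le> length \<pi>}" by auto
  then show ?thesis unfolding frame_count_def using card_length_eq_card_part_0[of n "Suc e"]
    by (simp add: Suc_le_eq)
qed

lemma frame_count_0_Suc:
  "frame_count e 0 (Suc n) = frame_count e 0 n +
    card {\<mu> \<in> partitions (Suc n). \<mu> = [1] \<and> e = 0 \<or> ones \<mu> = 0 \<and> e < part \<mu> 0}"
proof -
  let ?A = "{\<mu> \<in> partitions (Suc n). ones \<mu> = 0 \<and> e < part \<mu> 0}"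
  have 1: "frame_count e 0 (Suc n) = card ?A + card {\<mu> \<in> partitions (Suc n). ones \<mu> \<noteq> 0 \<and> e < part \<mu> 0}"
    unfolding frame_count_0_eq by (rule card_split_ones)
  \<comment> \<open>Appending a 1 changes the largest part only of the empty partition. This
    exception produces the partition \<open>[1]\<close> when \<open>e = 0\<close>, in agreement with
    \<open>crank1 [1] = 1\<close>.\<close>
  have 2: "e < part (\<pi> @ [1]) 0 \<longleftrightarrow> e < part \<pi> 0 \<or> e = 0 \<and> \<pi> = []" if "\<pi> \<in> partitions n" for \<pi>
    using that by (cases \<pi>) (auto simp: part_def partitions_def)
  have 3: "card {\<mu> \<in> partitions (Suc n). ones \<mu> \<noteq> 0 \<and> e < part \<mu> 0} =
    card {\<pi> \<in> partitions n. e < part \<pi> 0 \<or> e = 0 \<and> \<pi> = []}"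
    by (rule card_with_one) (rule 2)
  show ?thesis
  proof (cases "e = 0 \<and> n = 0")
    case True
    have "{\<pi> \<in> partitions 0. e < part \<pi> 0 \<or> e = 0 \<and> \<pi> = []} = {[]}" using True by (auto simp: partitions_0)
    moreover have "{\<mu> \<in> partitions (Suc n). \<mu> = [1] \<and> e = 0 \<or> ones \<mu> = 0 \<and> e < part \<mu> 0} = insert [1] ?A"
      using True by (auto simp: partitions_def)
    moreover have "card (insert [1] ?A) = Suc (card ?A)"
      by (rule card_insert_disjoint) (auto simp: ones_def intro: finite_subset[OF _ finite_partitions])
    ultimately show ?thesis using 1 3 True by (simp add: frame_count_0)
  next
    case False
    have "{\<pi> \<in> partitions n. e < part \<pi> 0 \<or> e = 0 \<and> \<pi> = []} = {\<pi> \<in> partitions n. e < part \<pi> 0}"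
      using False by (auto simp: partitions_def)
    moreover have "{\<mu> \<in> partitions (Suc n). \<mu> = [1] \<and> e = 0 \<or> ones \<mu> = 0 \<and> e < part \<mu> 0} = ?A"
      using False by (auto simp: partitions_def)
    ultimately show ?thesis using 1 3 by (simp add: frame_count_0_eq)
  qed
qed

section \<open>The recurrence for partitions of crank above a bound\<close>

definition crank_above :: "nat \<Rightarrow> nat \<Rightarrow> nat" where
  "crank_above e s = card {\<mu> \<in> partitions s. int e < crank1 \<mu>}"

lemma crank_above_0: "crank_above e 0 = 0"
proof -
  have "{\<mu> \<in> partitions 0. int e < crank1 \<mu>} = {}"
    by (auto simp: partitions_0 crank1_def crank_def ones_def)
  then show ?thesis by (simp only: crank_above_def card.empty)
qed

text \<open>The partitions of crank above \<open>e\<close> are sorted by their number of ones.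
  \<open>?G\<close> holds those without ones and possibly \<open>[1]\<close>, \<open>?B w\<close>
  those with \<open>w\<close> ones, and each class is the increment of one
  \<open>frame_count\<close>.\<close>

lemma crank_above_frame_sum: "crank_above e (Suc s) + frame_sum e s = frame_sum e (Suc s)"
proof -
  let ?B = "\<lambda>w. {\<mu> \<in> partitions (Suc s). ones \<mu> = w \<and> w < part \<mu> (w + e)}"
  let ?G = "{\<mu> \<in> partitions (Suc s). \<mu> = [1] \<and> e = 0 \<or> ones \<mu> = 0 \<and> e < part \<mu> 0}"
  have fin: "finite {\<mu> \<in> partitions (Suc s). P \<mu>}" for P
    using finite_partitions by simp
  have le: "ones \<mu> \<le> Suc s" if "\<mu> \<in> partitions (Suc s)" for \<mu>
    using that length_le_sum_list[of \<mu>]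
    by (auto simp: partitions_def ones_def intro: le_trans[OF length_filter_le])
  have "part [1] (1 + e) = 0" by (simp add: part_def)
  then have 1: "?G \<inter> ?B w = {}" if "w \<in> {1..Suc s}" for w
    using that by (auto simp: ones_def)
  have "int e < crank1 \<mu> \<longleftrightarrow> \<mu> \<in> ?G \<union> (\<Union>w\<in>{1..Suc s}. ?B w)" if "\<mu> \<in> partitions (Suc s)" for \<mu>
    using le[OF that] that by (auto simp: less_crank1_iff[OF that] Suc_le_eq)
  then have "{\<mu> \<in> partitions (Suc s). int e < crank1 \<mu>} = ?G \<union> (\<Union>w\<in>{1..Suc s}. ?B w)"
    by auto
  then have "crank_above e (Suc s) = card (?G \<union> (\<Union>w\<in>{1..Suc s}. ?B w))"
    by (simp only: crank_above_def)
  also have "\<dots> = card ?G + card (\<Union>w\<in>{1..Suc s}. ?B w)"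
    by (intro card_Un_disjoint fin finite_UN_I finite_atLeastAtMost) (use 1 in blast)
  also have "card (\<Union>w\<in>{1..Suc s}. ?B w) = (\<Sum>w=1..Suc s. card (?B w))"
    by (intro card_UN_disjoint) (auto simp: fin)
  \<comment> \<open>With \<open>w = Suc s\<close> all of \<open>Suc s\<close> is used up by the
    ones, so no part exceeds \<open>w\<close> and the last class is empty.\<close>
  also have "\<dots> = (\<Sum>w=1..s. card (?B w))"
  proof -
    have "card (?B (0 + Suc s)) = card {\<pi> \<in> partitions 0. ones \<pi> = 0 \<and> Suc s < part \<pi> (Suc s + e)}"
      using card_ones_eq[of "Suc s" 0] by simp
    also have "{\<pi> \<in> partitions 0. ones \<pi> = 0 \<and> Suc s < part \<pi> (Suc s + e)} = {}"
      by (auto simp: partitions_0 part_def)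
    finally have "card (?B (Suc s)) = 0" by (simp only: card.empty add_0)
    then show ?thesis by (subst sum.cl_ivl_Suc) (simp only:, simp)
  qed
  finally have c: "crank_above e (Suc s) = card ?G + (\<Sum>w=1..s. card (?B w))" .
  have "frame_sum e (Suc s) = (\<Sum>w\<le>s. frame_count e w (Suc s - w))"
    by (simp add: frame_sum_def frame_count_0)
  also have "\<dots> = frame_count e 0 (Suc s) + (\<Sum>w=1..s. frame_count e w (Suc s - w))"
    by (simp add: atMost_atLeast0 sum.atLeast_Suc_atMost)
  also have "(\<Sum>w=1..s. frame_count e w (Suc s - w)) = (\<Sum>w=1..s. frame_count e w (s - w) + card (?B w))"
  proof (rule sum.cong)
    fix w assume "w \<in> {1..s}"
    then show "frame_count e w (Suc s - w) = frame_count e w (s - w) + card (?B w)"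
      using frame_count_Suc[of w e "s - w"] by (simp add: Suc_diff_le)
  qed simp
  also have "frame_count e 0 (Suc s) = frame_count e 0 s + card ?G" by (rule frame_count_0_Suc)
  finally have "frame_sum e (Suc s) =
    frame_count e 0 s + (\<Sum>w=1..s. frame_count e w (s - w)) + crank_above e (Suc s)"
    using c by (simp add: sum.distrib)
  also have "frame_count e 0 s + (\<Sum>w=1..s. frame_count e w (s - w)) = frame_sum e s"
    by (simp add: frame_sum_def atMost_atLeast0 sum.atLeast_Suc_atMost)
  finally show ?thesis by simp
qed

text \<open>Reindexing by \<open>n = s - w\<close> turns \<open>w < durfee e (part \<pi>)\<close>
  into a threshold on size plus Durfee width.\<close>

lemma frame_sum_eq:
  "frame_sum e s = (\<Sum>n\<le>s. card {\<pi> \<in> partitions n. s < n + durfee e (part \<pi>)})"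
proof -
  have "frame_sum e s = (\<Sum>n\<le>s. frame_count e (s - n) n)"
    unfolding frame_sum_def by (rule sum.reindex_bij_witness[of _ "\<lambda>n. s - n" "\<lambda>n. s - n"]) auto
  also have "\<dots> = (\<Sum>n\<le>s. card {\<pi> \<in> partitions n. s < n + durfee e (part \<pi>)})"
  proof (rule sum.cong)
    fix n assume "n \<in> {..s}"
    then have "s - n < part \<pi> (s - n + e) \<longleftrightarrow> s < n + durfee e (part \<pi>)" if "\<pi> \<in> partitions n" for \<pi>
      using less_durfee_iff[OF part_in_diagrams(1)[OF that], of "s - n" e] by auto
    then show "frame_count e (s - n) n = card {\<pi> \<in> partitions n. s < n + durfee e (part \<pi>)}"
      unfolding frame_count_def by (intro arg_cong[of _ _ card]) auto
  qed simp
  finally show ?thesis .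
qed

lemma frame_sum_durfee_sum:
  "frame_sum e (Suc s) + card (durfee_sum e (Suc s)) = frame_sum e s + card (partitions (Suc s))"
proof -
  let ?D = "\<lambda>\<pi>. durfee e (part \<pi>)"
  have split: "card {\<pi> \<in> partitions n. Suc s < n + ?D \<pi>} + card {\<pi> \<in> partitions n. n + ?D \<pi> = Suc s} =
    card {\<pi> \<in> partitions n. Suc s \<le> n + ?D \<pi>}" for n
    by (subst card_Un_disjoint[symmetric])
      (auto intro: finite_subset[OF _ finite_partitions] arg_cong[of _ _ card])
  have "frame_sum e (Suc s) + card (durfee_sum e (Suc s)) =
    (\<Sum>n\<le>Suc s. card {\<pi> \<in> partitions n. Suc s \<le> n + ?D \<pi>})"
    unfolding frame_sum_eq card_durfee_sum sum.distrib[symmetric] split ..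
  \<comment> \<open>The threshold \<open>Suc s \<le> n + ?D \<pi>\<close> is
    \<open>s < n + ?D \<pi>\<close>: the terms \<open>n \<le> s\<close> form
    \<open>frame_sum e s\<close>, and for \<open>n = Suc s\<close> every partition
    qualifies.\<close>
  then show ?thesis by (simp add: frame_sum_eq Suc_le_eq)
qed

text \<open>Both readings of the increment of \<open>frame_sum e\<close> are equated.\<close>

lemma crank_above_durfee_sum: "crank_above e s + card (durfee_sum e s) = card (partitions s)"
proof (cases s)
  case 0
  then show ?thesis using durfee_sum_small[of 0 e] by (simp add: crank_above_0)
next
  case (Suc t)
  then show ?thesis using crank_above_frame_sum[of e t] frame_sum_durfee_sum[of e t] by simp
qed

lemma crank_above_small: "s < Suc e \<Longrightarrow> crank_above e s = 0"
  using crank_above_durfee_sum[of e s] durfee_sum_small[of s e] by simp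

text \<open>By \<open>durfee_sum_recurrence\<close>, the partitions of \<open>s + Suc e\<close>
  outside \<open>durfee_sum e\<close> are as many as \<open>durfee_sum (Suc e) s\<close>, which is
  the complement of crank above \<open>Suc e\<close> among the partitions of
  \<open>s\<close>.\<close>

lemma crank_above_recurrence:
  "crank_above e (s + Suc e) + crank_above (Suc e) s = card (partitions s)"
  using crank_above_durfee_sum[of e "s + Suc e"] crank_above_durfee_sum[of "Suc e" s]
    durfee_sum_recurrence[of s e] by simp

subsection \<open>Runs of consecutive integers\<close>

fun run_sum :: "nat \<Rightarrow> nat \<Rightarrow> nat" where
  "run_sum 0 m = 0"
| "run_sum (Suc j) m = m + run_sum j (Suc m)"

text \<open>The arithmetic series formula, doubled and with \<open>j\<close> moved to the left to
  avoid division and subtraction on naturals.\<close>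

lemma run_sum_eq: "2 * run_sum j m + j = j * (2 * m + j)"
proof (induction j arbitrary: m)
  case (Suc j)
  show ?case using Suc[of "Suc m"] by (simp add: algebra_simps)
qed simp

lemma run_sum_ge: "1 \<le> m \<Longrightarrow> j \<le> run_sum j m"
proof (induction j arbitrary: m)
  case (Suc j)
  have "j \<le> run_sum j (Suc m)" by (rule Suc.IH) simp
  then show ?case using Suc.prems by simp
qed simp

lemma run_sum_ge_start: "1 \<le> j \<Longrightarrow> m \<le> run_sum j m"
  by (cases j) simp_all

text \<open>The explicit 0 is needed because truncated subtraction would give
  \<open>partitions 0\<close>, which has one element, whenever \<open>y > s\<close>.\<close>

definition partitions_below :: "nat \<Rightarrow> nat \<Rightarrow> int" where
  "partitions_below s y = (if y \<le> s then int (card (partitions (s - y))) else 0)"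

text \<open>The recurrence is unrolled by strong induction on \<open>s\<close>. A run of length
  above \<open>s\<close> sums to more than \<open>s\<close>, so every cutoff \<open>J\<close> from
  \<open>s\<close> on gives the same value; this freedom lets the cutoff drop by one in each
  step.\<close>

lemma crank_above_run_sum:
  "s \<le> J \<Longrightarrow> int (crank_above e s) =
    (\<Sum>j<J. (- 1) ^ j * partitions_below s (run_sum (Suc j) (Suc e)))"
proof (induction s arbitrary: e J rule: less_induct)
  case (less s)
  show ?case
  proof (cases "s < Suc e")
    case True
    then have "partitions_below s (run_sum (Suc j) (Suc e)) = 0" for j
      by (simp add: partitions_below_def)
    then show ?thesis using True by (simp add: crank_above_small)
  next
    case False
    then obtain t where s: "s = t + Suc e" by (metis le_add_diff_inverse2 not_less)
    obtain K where J: "J = Suc K" using less.prems s by (cases J) auto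
    have *: "partitions_below s (Suc e + y) = partitions_below t y" for y
      by (simp add: partitions_below_def s)
    \<comment> \<open>Prepending \<open>Suc e\<close> to a run starting at
      \<open>Suc (Suc e)\<close> gives the run starting at \<open>Suc e\<close> that is one
      longer.\<close>
    have **: "partitions_below s (run_sum (Suc (Suc j)) (Suc e)) =
        partitions_below t (run_sum (Suc j) (Suc (Suc e)))" for j
      unfolding run_sum.simps(2)[of "Suc j" "Suc e"] by (rule *)
    have "int (crank_above e s) = int (card (partitions t)) - int (crank_above (Suc e) t)"
      using crank_above_recurrence[of e t] unfolding s by linarith
    also have "int (crank_above (Suc e) t) =
      (\<Sum>j<K. (- 1) ^ j * partitions_below t (run_sum (Suc j) (Suc (Suc e))))"
      by (rule less.IH) (use s J less.prems in auto)
    also have "int (card (partitions t)) = partitions_below s (run_sum 1 (Suc e))"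
      using *[of 0] by (simp add: partitions_below_def)
    also have "partitions_below s (run_sum 1 (Suc e)) -
        (\<Sum>j<K. (- 1) ^ j * partitions_below t (run_sum (Suc j) (Suc (Suc e)))) =
      (\<Sum>j<J. (- 1) ^ j * partitions_below s (run_sum (Suc j) (Suc e)))"
      unfolding J sum.lessThan_Suc_shift by (simp add: ** sum_negf del: run_sum.simps)
    finally show ?thesis .
  qed
qed

section \<open>Nonnegativity of the run coefficients\<close>

definition run_pairs :: "nat \<Rightarrow> (nat \<times> nat) set" where
  "run_pairs y = {(j, m). 1 \<le> j \<and> 1 \<le> m \<and> run_sum j m = y}"

text \<open>This is the coefficient \<open>g(y)\<close>: the sign comes from the alternating
  expansion, the difference of powers from summation by parts over the crank.\<close>

definition run_coeff :: "nat \<Rightarrow> nat \<Rightarrow> int" where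
  "run_coeff k y = (\<Sum>(j, m)\<in>run_pairs y. (- 1) ^ (j - 1) * (int m ^ k - int (m - 1) ^ k))"

lemma run_pairs_subset: "run_pairs y \<subseteq> {1..y} \<times> {1..y}"
  using run_sum_ge run_sum_ge_start by (auto simp: run_pairs_def)

lemma finite_run_pairs: "finite (run_pairs y)"
  by (rule finite_subset[OF run_pairs_subset]) simp

text \<open>Discrete convexity of the \<open>k\<close>th power on the naturals.\<close>

lemma power_diff_mono:
  assumes "1 \<le> m" "m \<le> n"
  shows "int m ^ k - int (m - 1) ^ k \<le> int n ^ k - int (n - 1) ^ k"
proof -
  \<comment> \<open>Induction on the exponent by a product rule: the difference for
    \<open>Suc k\<close> is \<open>n\<close> times the one for \<open>k\<close> plus
    \<open>Suc n ^ k\<close>, and the next difference is \<open>n + 2\<close> times its counterpart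
    plus the same power.\<close>
  have step: "int (Suc n) ^ k - int n ^ k \<le> int (Suc (Suc n)) ^ k - int (Suc n) ^ k" for n
  proof (induction k)
    case (Suc k)
    let ?a = "int (Suc n) ^ k - int n ^ k" and ?b = "int (Suc (Suc n)) ^ k - int (Suc n) ^ k"
    have b: "0 \<le> ?b" by (simp add: power_mono)
    have "int (Suc n) ^ Suc k - int n ^ Suc k = int n * ?a + int (Suc n) ^ k"
      by (simp add: algebra_simps)
    also have "\<dots> \<le> int n * ?b + int (Suc n) ^ k" using Suc by (simp add: mult_left_mono)
    also have "\<dots> \<le> int (Suc (Suc n)) * ?b + int (Suc n) ^ k" using b by (simp add: mult_right_mono)
    also have "\<dots> = int (Suc (Suc n)) ^ Suc k - int (Suc n) ^ Suc k" by (simp add: algebra_simps)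
    finally show ?case .
  qed simp
  have "int (Suc a) ^ k - int a ^ k \<le> int (Suc b) ^ k - int b ^ k" if "a \<le> b" for a b
    using lift_Suc_mono_le[of "\<lambda>n. int (Suc n) ^ k - int n ^ k", OF step that] .
  from this[of "m - 1" "n - 1"] assms show ?thesis by simp
qed

lemma two_power_odd_unique:
  fixes a b :: nat
  assumes "2 ^ e * a = 2 ^ f * b" "odd a" "odd b"
  shows "e = f \<and> a = b"
proof -
  have "e = f"
    using assms
  proof (induction e arbitrary: f)
    case 0
    then show ?case by (cases f) auto
  next
    case (Suc e)
    then show ?case by (cases f) auto
  qed
  then show ?thesis using assms by simp
qed

lemma two_power_odd_ex:
  fixes n :: nat
  assumes "0 < n"
  shows "\<exists>e h. n = 2 ^ e * (2 * h + 1)"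
  using assms
proof (induction n rule: less_induct)
  case (less n)
  show ?case
  proof (cases "even n")
    case True
    then obtain i where i: "n = 2 * i" by blast
    have "i < n" "0 < i" using i less.prems by auto
    then obtain e h where "i = 2 ^ e * (2 * h + 1)" using less.IH by blast
    then have "n = 2 ^ Suc e * (2 * h + 1)" using i by simp
    then show ?thesis by blast
  next
    case False
    then have "n = 2 ^ 0 * (2 * (n div 2) + 1)" by simp
    then show ?thesis by blast
  qed
qed

text \<open>A run of even length \<open>2 * i\<close> starting at \<open>m\<close>, with \<open>i = 2 ^ e * (2 * h + 1)\<close>, has the same sum
  as the run of odd length \<open>2 * h + 1\<close> centred at \<open>2 ^ e * (2 * m + 2 * i - 1)\<close>. The factor
  \<open>2 * m + 2 * i - 1\<close> is odd, so the exponent \<open>e\<close> can be recovered.\<close>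

definition odd_run_of :: "nat \<times> nat \<Rightarrow> nat \<times> nat \<Rightarrow> bool" where
  "odd_run_of p q \<longleftrightarrow> (\<exists>e h. fst p = 2 * (2 ^ e * (2 * h + 1)) \<and> fst q = 2 * h + 1 \<and>
     snd q + h = 2 ^ e * (2 * snd p + fst p - 1))"

lemma odd_run_exists:
  assumes "p \<in> run_pairs y" "even (fst p)"
  shows "\<exists>q. q \<in> run_pairs y \<and> odd (fst q) \<and> snd p \<le> snd q \<and> odd_run_of p q"
proof -
  obtain j m where p: "p = (j, m)" by (cases p)
  have jm: "1 \<le> j" "1 \<le> m" "run_sum j m = y" using assms p by (auto simp: run_pairs_def)
  obtain i where i: "j = 2 * i" using assms p by auto
  obtain e h where h: "i = 2 ^ e * (2 * h + 1)" using two_power_odd_ex[of i] i jm by auto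
  \<comment> \<open>The centre of the odd run: its sum is its length \<open>2 * h + 1\<close> times
    \<open>c\<close>.\<close>
  define c where "c = 2 ^ e * (2 * m + j - 1)"
  have ih: "2 * h + 1 \<le> i" unfolding h using mult_le_mono1[of 1 "2 ^ e" "2 * h + 1"] by simp
  have "2 * m + j - 1 \<le> c" unfolding c_def by simp
  \<comment> \<open>This makes \<open>c - h\<close> an exact subtraction and also shows that the odd
    run starts no earlier than \<open>m\<close>.\<close>
  then have mc: "m + h \<le> c" using ih i jm by linarith
  have y: "y = (2 * h + 1) * c"
  proof -
    have "2 * y + j = j * (2 * m + j)" using run_sum_eq[of j m] jm by simp
    also have "j * (2 * m + j) = j * (2 * m + j - 1) + j"
      using jm by (metis Suc_pred' add.commute add_gr_0 mult_Suc_right diff_Suc_1 One_nat_def Suc_le_eq)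
    finally have "y = i * (2 * m + j - 1)" using i by simp
    then show ?thesis by (simp only: h c_def mult_ac)
  qed
  let ?q = "(2 * h + 1, c - h)"
  have "2 * run_sum (2 * h + 1) (c - h) + (2 * h + 1) = (2 * h + 1) * (2 * (c - h) + (2 * h + 1))"
    by (rule run_sum_eq)
  also have "2 * (c - h) + (2 * h + 1) = 2 * c + 1" using mc by simp
  finally have "run_sum (2 * h + 1) (c - h) = y" unfolding y by simp
  then have "?q \<in> run_pairs y" using mc jm by (simp add: run_pairs_def)
  moreover have "odd_run_of p ?q" unfolding odd_run_of_def
    using mc by (intro exI[of _ e] exI[of _ h]) (simp add: p i h c_def)
  moreover have "snd p \<le> snd ?q" "odd (fst ?q)" using mc p by auto
  ultimately show ?thesis by blast
qed

text \<open>The length of \<open>q\<close> gives \<open>h\<close>, the power of 2 in its centre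
  gives \<open>e\<close>; together they determine the length of \<open>p\<close>, and the odd factor
  of the centre then gives its start.\<close>

lemma odd_run_inj:
  assumes "odd_run_of p q" "odd_run_of p' q" "1 \<le> fst p" "1 \<le> fst p'"
  shows "p = p'"
proof -
  obtain e h where 1: "fst p = 2 * (2 ^ e * (2 * h + 1))" "fst q = 2 * h + 1"
    "snd q + h = 2 ^ e * (2 * snd p + fst p - 1)" using assms(1) by (auto simp: odd_run_of_def)
  obtain e' h' where 2: "fst p' = 2 * (2 ^ e' * (2 * h' + 1))" "fst q = 2 * h' + 1"
    "snd q + h' = 2 ^ e' * (2 * snd p' + fst p' - 1)" using assms(2) by (auto simp: odd_run_of_def)
  have h: "h' = h" using 1 2 by simp
  have "even (fst p)" "even (fst p')" using 1 2 by simp_all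
  \<comment> \<open>The lengths are even and positive, so subtracting 1 is exact and leaves odd
    numbers.\<close>
  then have o: "odd (2 * snd p + fst p - 1)" "odd (2 * snd p' + fst p' - 1)" using assms by auto
  have "2 ^ e * (2 * snd p + fst p - 1) = 2 ^ e' * (2 * snd p' + fst p' - 1)" using 1 2 h by simp
  from two_power_odd_unique[OF this o]
  have "e = e'" and *: "2 * snd p + fst p - 1 = 2 * snd p' + fst p' - 1" by auto
  then have "fst p = fst p'" using 1 2 h by simp
  then show ?thesis using * assms by (simp add: prod_eq_iff)
qed

text \<open>The negative terms are those of even length. By convexity each is outweighed by the term
  of its matched odd run, and unmatched odd runs contribute nonnegatively.\<close>

lemma run_coeff_nonneg: "0 \<le> run_coeff k y"
proof -
  let ?w = "\<lambda>q. int (snd q) ^ k - int (snd q - 1) ^ k"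
  let ?E = "{p \<in> run_pairs y. even (fst p)}" and ?O = "{p \<in> run_pairs y. odd (fst p)}"
  have fin: "finite ?E" "finite ?O" using finite_run_pairs by auto
  have "\<forall>p\<in>?E. \<exists>q. q \<in> run_pairs y \<and> odd (fst q) \<and> snd p \<le> snd q \<and> odd_run_of p q"
    using odd_run_exists by blast
  then obtain g where g: "\<And>p. p \<in> ?E \<Longrightarrow> g p \<in> ?O \<and> snd p \<le> snd (g p) \<and> odd_run_of p (g p)"
    by (metis (mono_tags, lifting) mem_Collect_eq)
  have pos: "1 \<le> fst p" "1 \<le> snd p" if "p \<in> run_pairs y" for p
    using that by (auto simp: run_pairs_def)
  have inj: "inj_on g ?E"
  proof (rule inj_onI)
    fix p p' assume "p \<in> ?E" "p' \<in> ?E" "g p = g p'"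
    then show "p = p'" using odd_run_inj[of p "g p" p'] g[of p] g[of p'] pos by auto
  qed
  have "(\<Sum>p\<in>?E. ?w p) \<le> (\<Sum>p\<in>?E. ?w (g p))"
    using g pos by (intro sum_mono power_diff_mono) auto
  also have "\<dots> = (\<Sum>q\<in>g ` ?E. ?w q)" using inj by (simp add: sum.reindex)
  also have "\<dots> \<le> (\<Sum>q\<in>?O. ?w q)"
    using g by (intro sum_mono2 fin) (auto intro!: power_mono)
  finally have le: "(\<Sum>p\<in>?E. ?w p) \<le> (\<Sum>q\<in>?O. ?w q)" .
  have "run_coeff k y = (\<Sum>p\<in>run_pairs y. (- 1) ^ (fst p - 1) * ?w p)"
    by (simp add: run_coeff_def case_prod_beta')
  also have "\<dots> = (\<Sum>p\<in>?E \<union> ?O. (- 1) ^ (fst p - 1) * ?w p)"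
    by (rule sum.cong) auto
  also have "\<dots> = (\<Sum>p\<in>?E. (- 1) ^ (fst p - 1) * ?w p) + (\<Sum>p\<in>?O. (- 1) ^ (fst p - 1) * ?w p)"
    by (rule sum.union_disjoint) (use fin in auto)
  also have "(\<Sum>p\<in>?E. (- 1) ^ (fst p - 1) * ?w p) = (\<Sum>p\<in>?E. - ?w p)"
  proof (rule sum.cong)
    fix p assume p: "p \<in> ?E"
    then have "odd (fst p - 1)" using pos[of p] by simp
    then show "(- 1) ^ (fst p - 1) * ?w p = - ?w p" by (simp only: uminus_power_if) simp
  qed simp
  also have "(\<Sum>p\<in>?O. (- 1) ^ (fst p - 1) * ?w p) = (\<Sum>p\<in>?O. ?w p)"
    using pos by (intro sum.cong) auto
  finally show ?thesis using le unfolding sum_negf by linarith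
qed

lemma run_coeff_1: "1 \<le> k \<Longrightarrow> run_coeff k 1 = 1"
proof -
  assume k: "1 \<le> k"
  have "run_pairs 1 = {(1, 1)}"
    using run_pairs_subset[of 1] by (auto simp: run_pairs_def)
  then show ?thesis using k by (simp add: run_coeff_def power_0_left)
qed

section \<open>Power sums of the positive cranks\<close>

lemma crank1_le:
  assumes "\<mu> \<in> partitions s"
  shows "crank1 \<mu> \<le> int s"
proof -
  have len: "length \<mu> \<le> s" using assms length_le_sum_list by (auto simp: partitions_def)
  have "p \<le> s" if "p \<in> set \<mu>" for p
    using assms member_le_sum_list[OF that] by (simp add: partitions_def)
  moreover have "length (filter (\<lambda>p. p > ones \<mu>) \<mu>) \<le> s" using len le_trans[OF length_filter_le] by blast
  ultimately show ?thesis using assms by (auto simp: crank1_def crank_def partitions_def)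
qed

definition crank_power :: "nat \<Rightarrow> nat list \<Rightarrow> int" where
  "crank_power k \<mu> = (if 1 \<le> crank1 \<mu> then crank1 \<mu> ^ k else 0)"

lemma sum_crank_power:
  assumes "1 \<le> k"
  shows "(\<Sum>\<mu>\<in>partitions s. crank_power k \<mu>) =
    (\<Sum>y=1..s. run_coeff k y * int (card (partitions (s - y))))"
proof -
  let ?\<phi> = "\<lambda>m. int m ^ k - int (m - 1) ^ k"
  \<comment> \<open>Telescoping needs \<open>k\<close> positive, so that the bottom term
    \<open>0 ^ k\<close> vanishes. It turns a power of the crank into a sum over the thresholds
    \<open>m\<close> that the crank reaches.\<close>
  have tel: "(\<Sum>m=1..c. ?\<phi> m) = int c ^ k" for c
    using assms by (induction c) (auto simp: power_0_left)
  have W: "crank_power k \<mu> = (\<Sum>m=1..s. if int (m - 1) < crank1 \<mu> then ?\<phi> m else 0)"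
    if "\<mu> \<in> partitions s" for \<mu>
  proof (cases "1 \<le> crank1 \<mu>")
    case True
    then obtain c where c: "crank1 \<mu> = int c" by (metis nat_0_le order_trans zero_le_one)
    have "(\<Sum>m=1..s. if int (m - 1) < crank1 \<mu> then ?\<phi> m else 0) =
      (\<Sum>m\<in>{m\<in>{1..s}. m - 1 < c}. ?\<phi> m)"
      by (simp only: c of_nat_less_iff sum.inter_filter[OF finite_atLeastAtMost])
    also have "{m\<in>{1..s}. m - 1 < c} = {1..c}" using crank1_le[OF that] c by auto
    finally have "(\<Sum>m=1..s. if int (m - 1) < crank1 \<mu> then ?\<phi> m else 0) = int c ^ k"
      unfolding tel .
    with True show ?thesis unfolding crank_power_def by (simp only: if_True) (simp only: c)
  qed (simp add: crank_power_def)
  have "(\<Sum>\<mu>\<in>partitions s. crank_power k \<mu>) =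
    (\<Sum>\<mu>\<in>partitions s. \<Sum>m=1..s. if int (m - 1) < crank1 \<mu> then ?\<phi> m else 0)"
    by (intro sum.cong W refl)
  also have "\<dots> = (\<Sum>m=1..s. \<Sum>\<mu>\<in>partitions s. if int (m - 1) < crank1 \<mu> then ?\<phi> m else 0)"
    by (rule sum.swap)
  also have "\<dots> = (\<Sum>m=1..s. ?\<phi> m * int (crank_above (m - 1) s))"
    by (simp add: crank_above_def finite_partitions mult.commute flip: sum.inter_filter)
  also have "\<dots> = (\<Sum>m=1..s. \<Sum>j=1..s. (- 1) ^ (j - 1) * ?\<phi> m * partitions_below s (run_sum j m))"
  proof (rule sum.cong)
    fix m assume m: "m \<in> {1..s}"
    have "int (crank_above (m - 1) s) = (\<Sum>j<s. (- 1) ^ j * partitions_below s (run_sum (Suc j) m))"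
      using crank_above_run_sum[of s s "m - 1"] m by simp
    also have "\<dots> = (\<Sum>j=1..s. (- 1) ^ (j - 1) * partitions_below s (run_sum j m))"
      by (rule sum.reindex_bij_witness[of _ "\<lambda>j. j - 1" Suc]) auto
    finally show "?\<phi> m * int (crank_above (m - 1) s) =
      (\<Sum>j=1..s. (- 1) ^ (j - 1) * ?\<phi> m * partitions_below s (run_sum j m))"
      by (simp add: sum_distrib_left mult_ac)
  qed simp
  also have "\<dots> = (\<Sum>(j, m)\<in>{1..s} \<times> {1..s}. (- 1) ^ (j - 1) * ?\<phi> m * partitions_below s (run_sum j m))"
    by (subst sum.swap) (simp only: sum.cartesian_product)
  \<comment> \<open>Runs are now grouped by their sum \<open>y\<close>; those with sum above
    \<open>s\<close> contribute 0 on both sides.\<close>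
  also have "\<dots> = (\<Sum>(j, m)\<in>{1..s} \<times> {1..s}. \<Sum>y=1..s.
    if run_sum j m = y then (- 1) ^ (j - 1) * ?\<phi> m * int (card (partitions (s - y))) else 0)"
  proof (intro sum.cong refl, clarify)
    fix j m assume "j \<in> {1..s}" "m \<in> {1..s}"
    then have "1 \<le> run_sum j m" using run_sum_ge[of m j] by auto
    then show "(- 1) ^ (j - 1) * ?\<phi> m * partitions_below s (run_sum j m) = (\<Sum>y=1..s.
      if run_sum j m = y then (- 1) ^ (j - 1) * ?\<phi> m * int (card (partitions (s - y))) else 0)"
      by (simp add: partitions_below_def)
  qed
  also have "\<dots> = (\<Sum>y=1..s. \<Sum>(j, m)\<in>{1..s} \<times> {1..s}.
    if run_sum j m = y then (- 1) ^ (j - 1) * ?\<phi> m * int (card (partitions (s - y))) else 0)"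
    unfolding case_prod_beta' by (rule sum.swap)
  also have "\<dots> = (\<Sum>y=1..s. run_coeff k y * int (card (partitions (s - y))))"
  proof (rule sum.cong)
    fix y assume y: "y \<in> {1..s}"
    have "run_pairs y = {p \<in> {1..s} \<times> {1..s}. run_sum (fst p) (snd p) = y}"
    proof (intro equalityI subsetI)
      fix p assume p: "p \<in> run_pairs y"
      then have "p \<in> {1..y} \<times> {1..y}" using run_pairs_subset by blast
      with p y show "p \<in> {p \<in> {1..s} \<times> {1..s}. run_sum (fst p) (snd p) = y}"
        by (auto simp: run_pairs_def)
    qed (auto simp: run_pairs_def)
    then show "(\<Sum>(j, m)\<in>{1..s} \<times> {1..s}.
      if run_sum j m = y then (- 1) ^ (j - 1) * ?\<phi> m * int (card (partitions (s - y))) else 0) =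
      run_coeff k y * int (card (partitions (s - y)))"
      by (simp add: run_coeff_def case_prod_beta' sum_distrib_right flip: sum.inter_filter)
  qed simp
  finally show ?thesis .
qed

subsection \<open>Overpartitions and the residual crank\<close>

text \<open>Sorting by this key puts larger parts first and, among equal parts, the overlined one first.\<close>

definition op_key :: "nat \<times> bool \<Rightarrow> int" where
  "op_key x = (if snd x then - 2 * int (fst x) - 1 else - 2 * int (fst x))"

lemma inj_op_key: "inj op_key"
proof (rule injI)
  fix x y :: "nat \<times> bool" assume "op_key x = op_key y"
  moreover have "int (fst x) * 2 \<noteq> int (fst y) * 2 + 1" "int (fst x) * 2 + 1 \<noteq> int (fst y) * 2" by presburger+
  ultimately show "x = y" by (auto simp: op_key_def prod_eq_iff split: if_splits)
qed

text \<open>Both sides are conditions on pairs of entries: a later overlined entry must differ in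
  size from every earlier one. With the key order, only a repeated overlined part remains to be
  excluded.\<close>

lemma overpartition_sorted_iff:
  "sorted_wrt (\<ge>) (map fst xs) \<and>
    (\<forall>i < length xs. snd (xs ! i) \<longrightarrow> (\<forall>j < i. fst (xs ! j) \<noteq> fst (xs ! i))) \<longleftrightarrow>
   sorted (map op_key xs) \<and> distinct (filter snd xs)" (is "?L xs \<longleftrightarrow> ?R xs")
proof -
  let ?S = "\<lambda>x y. fst y \<le> fst x" and ?O = "\<lambda>x y. snd y \<longrightarrow> fst x \<noteq> fst y"
  have "?L xs \<longleftrightarrow> sorted_wrt ?S xs \<and> sorted_wrt ?O xs"
    by (auto simp: sorted_wrt_map sorted_wrt_iff_nth_less[of ?O])
  also have "\<dots> \<longleftrightarrow> ?R xs"
  proof (induction xs)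
    case (Cons x xs)
    have "(?S x y \<and> ?O x y) \<longleftrightarrow> op_key x \<le> op_key y \<and> (snd x \<and> snd y \<longrightarrow> x \<noteq> y)" for y
      by (cases x; cases y) (auto simp: op_key_def)
    then have "(\<forall>y\<in>set xs. ?S x y) \<and> (\<forall>y\<in>set xs. ?O x y) \<longleftrightarrow>
        (\<forall>y\<in>set xs. op_key x \<le> op_key y) \<and> (snd x \<longrightarrow> x \<notin> set (filter snd xs))"
      unfolding ball_conj_distrib[symmetric] by auto
    then show ?case using Cons by auto
  qed simp
  finally show ?thesis .
qed

lemma overpartitions_iff:
  "xs \<in> overpartitions n \<longleftrightarrow> sorted (map op_key xs) \<and> distinct (filter snd xs) \<and>
    (\<forall>x\<in>set xs. 1 \<le> fst x) \<and> sum_list (map fst xs) = n"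
  unfolding overpartitions_def mem_Collect_eq using overpartition_sorted_iff[of xs] by auto

definition divisible_plain :: "nat \<Rightarrow> nat \<times> bool \<Rightarrow> bool" where
  "divisible_plain d x \<longleftrightarrow> \<not> snd x \<and> d dvd fst x"

definition scale_up :: "nat \<Rightarrow> nat list \<Rightarrow> (nat \<times> bool) list" where
  "scale_up d \<mu> = map (\<lambda>p. (d * p, False)) \<mu>"

definition residual_rest :: "nat \<Rightarrow> nat \<Rightarrow> (nat \<times> bool) list set" where
  "residual_rest d n = {xs \<in> overpartitions n. \<forall>x\<in>set xs. \<not> divisible_plain d x}"

definition merge_residual :: "nat \<Rightarrow> nat list \<Rightarrow> (nat \<times> bool) list \<Rightarrow> (nat \<times> bool) list" where
  "merge_residual d \<mu> ys = sort_key op_key (scale_up d \<mu> @ ys)"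

lemma residual_partition_eq:
  "residual_partition d xs = map (\<lambda>x. fst x div d) (filter (divisible_plain d) xs)"
  by (simp add: residual_partition_def divisible_plain_def cong: filter_cong)

lemma scale_up_residual: "scale_up d (residual_partition d xs) = filter (divisible_plain d) xs"
  unfolding scale_up_def residual_partition_eq map_map
  by (rule map_idI) (auto simp: divisible_plain_def)

lemma residual_scale_up:
  assumes "0 < d"
  shows "map (\<lambda>x. fst x div d) (scale_up d \<mu>) = \<mu>"
  using assms by (simp add: scale_up_def o_def)

lemma sorted_scale_up: "sorted_wrt (\<ge>) \<mu> \<Longrightarrow> sorted (map op_key (scale_up d \<mu>))"
  by (induction \<mu>) (auto simp: scale_up_def op_key_def intro!: mult_left_mono)

lemma sum_scale_up: "sum_list (map fst (scale_up d \<mu>)) = d * sum_list \<mu>"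
  by (simp add: scale_up_def o_def sum_list_const_mult)

lemma merge_in_overpartitions:
  assumes "\<mu> \<in> partitions s" "ys \<in> residual_rest d n" "0 < d"
  shows "merge_residual d \<mu> ys \<in> overpartitions (d * s + n)"
proof -
  let ?zs = "scale_up d \<mu> @ ys"
  have m: "mset (merge_residual d \<mu> ys) = mset ?zs" by (simp add: merge_residual_def)
  have ys: "ys \<in> overpartitions n" using assms by (simp add: residual_rest_def)
  have "filter snd (scale_up d \<mu>) = []" by (simp add: scale_up_def filter_empty_conv)
  then have "filter snd ?zs = filter snd ys" by simp
  then have "mset (filter snd (merge_residual d \<mu> ys)) = mset (filter snd ys)"
    using m by (metis mset_filter)
  then have "distinct (filter snd (merge_residual d \<mu> ys))"
    using ys by (metis overpartitions_iff mset_eq_imp_distinct_iff)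
  moreover have "sum_list (map fst (merge_residual d \<mu> ys)) = sum_list (map fst ?zs)"
    by (metis m mset_map sum_mset_sum_list)
  then have "sum_list (map fst (merge_residual d \<mu> ys)) = d * s + n"
    using ys assms(1) by (simp add: sum_scale_up overpartitions_iff partitions_def)
  moreover have "\<forall>x\<in>set (merge_residual d \<mu> ys). 1 \<le> fst x"
    using ys assms(1,3) by (auto simp: merge_residual_def scale_up_def overpartitions_iff partitions_def Suc_le_eq)
  ultimately show ?thesis by (simp add: overpartitions_iff merge_residual_def)
qed

text \<open>Filtering commutes with stable sorting, and each of the two merged lists is already
  sorted by the key.\<close>

lemma filter_merge_residual:
  assumes "\<mu> \<in> partitions s" "ys \<in> residual_rest d n" "0 < d"
  shows "residual_partition d (merge_residual d \<mu> ys) = \<mu>"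
    and "filter (\<lambda>x. \<not> divisible_plain d x) (merge_residual d \<mu> ys) = ys"
proof -
  have y: "\<forall>x\<in>set ys. \<not> divisible_plain d x" "sorted (map op_key ys)"
    using assms by (auto simp: residual_rest_def overpartitions_iff)
  have z: "\<forall>x\<in>set (scale_up d \<mu>). divisible_plain d x" "sorted (map op_key (scale_up d \<mu>))"
    using assms(1) sorted_scale_up by (auto simp: scale_up_def divisible_plain_def partitions_def)
  have "filter (divisible_plain d) (scale_up d \<mu> @ ys) = scale_up d \<mu>"
    "filter (\<lambda>x. \<not> divisible_plain d x) (scale_up d \<mu> @ ys) = ys"
    using y z by (auto simp: filter_id_conv filter_empty_conv)
  then have "filter (divisible_plain d) (merge_residual d \<mu> ys) = scale_up d \<mu>"
    "filter (\<lambda>x. \<not> divisible_plain d x) (merge_residual d \<mu> ys) = ys"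
    using y z by (simp_all add: merge_residual_def filter_sort sort_key_id_if_sorted)
  then show "residual_partition d (merge_residual d \<mu> ys) = \<mu>"
    and "filter (\<lambda>x. \<not> divisible_plain d x) (merge_residual d \<mu> ys) = ys"
    using assms(3) by (simp_all add: residual_partition_eq residual_scale_up)
qed

text \<open>The key is injective, so a sorted list is determined by its multiset of entries.\<close>

lemma merge_filter:
  assumes "xs \<in> overpartitions n"
  shows "merge_residual d (residual_partition d xs) (filter (\<lambda>x. \<not> divisible_plain d x) xs) = xs"
  unfolding merge_residual_def scale_up_residual
proof (rule sort_key_inj_key_eq)
  show "mset (filter (divisible_plain d) xs @ filter (\<lambda>x. \<not> divisible_plain d x) xs) = mset xs"
    by (simp add: mset_filter)
  show "inj_on op_key (set (filter (divisible_plain d) xs @ filter (\<lambda>x. \<not> divisible_plain d x) xs))"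
    using inj_op_key inj_on_subset by blast
  show "sorted (map op_key xs)" using assms by (simp add: overpartitions_iff)
qed

lemma residual_split:
  assumes "xs \<in> overpartitions n" "0 < d"
  obtains s where "d * s \<le> n" "residual_partition d xs \<in> partitions s"
    "filter (\<lambda>x. \<not> divisible_plain d x) xs \<in> residual_rest d (n - d * s)"
proof
  let ?s = "sum_list (residual_partition d xs)"
  let ?ys = "filter (\<lambda>x. \<not> divisible_plain d x) xs"
  have xs: "sorted (map op_key xs)" "distinct (filter snd xs)" "\<forall>x\<in>set xs. 1 \<le> fst x"
    "sum_list (map fst xs) = n" using assms by (auto simp: overpartitions_iff)
  have "sum_list (map fst xs) = sum_list (map fst (filter (divisible_plain d) xs)) + sum_list (map fst ?ys)"
    by (induction xs) auto
  then have sum: "n = d * ?s + sum_list (map fst ?ys)"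
    using xs by (simp add: sum_scale_up flip: scale_up_residual)
  then show "d * ?s \<le> n" by simp
  have "sorted_wrt (\<ge>) (map fst xs)" using assms by (simp add: overpartitions_def)
  then have "sorted_wrt (\<ge>) (residual_partition d xs)"
    unfolding residual_partition_eq sorted_wrt_map
    by (intro sorted_wrt_filter) (auto elim!: sorted_wrt_mono_rel[rotated] intro: div_le_mono)
  moreover have "1 \<le> x" if x: "x \<in> set (residual_partition d xs)" for x
  proof -
    obtain z where "z \<in> set xs" "d dvd fst z" "x = fst z div d"
      using x by (auto simp: residual_partition_def)
    then show ?thesis using xs(3) assms(2) by (force elim!: dvdE)
  qed
  ultimately show "residual_partition d xs \<in> partitions ?s" by (simp add: partitions_def)
  have "distinct (filter snd ?ys)"
  proof -
    have "filter snd ?ys = filter (\<lambda>x. \<not> divisible_plain d x) (filter snd xs)"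
      by (simp add: conj_commute)
    then show ?thesis using xs(2) by (metis distinct_filter)
  qed
  then show "?ys \<in> residual_rest d (n - d * ?s)"
    using xs sum sorted_filter[OF xs(1)] by (simp add: residual_rest_def overpartitions_iff)
qed

lemma finite_residual_rest: "finite (residual_rest d n)"
  by (simp add: residual_rest_def finite_overpartitions)

text \<open>An overpartition amounts to a partition of some \<open>s\<close>, scaled by
  \<open>d\<close>, and an independent remainder of size \<open>n - d * s\<close>. Taking
  \<open>F\<close> constant counts overpartitions, taking a crank power gives the moments.\<close>

lemma sum_overpartitions:
  fixes F :: "nat list \<Rightarrow> int"
  assumes "0 < d"
  shows "(\<Sum>xs\<in>overpartitions n. F (residual_partition d xs)) =
    (\<Sum>s\<le>n div d. (\<Sum>\<mu>\<in>partitions s. F \<mu>) * int (card (residual_rest d (n - d * s))))"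
proof -
  let ?f = "\<lambda>xs. filter (\<lambda>x. \<not> divisible_plain d x) xs"
  let ?S = "SIGMA s:{..n div d}. partitions s \<times> residual_rest d (n - d * s)"
  have ds: "d * s \<le> n" if "s \<le> n div d" for s using that assms by (simp add: less_eq_div_iff_mult_less_eq mult.commute)
  have "(\<Sum>xs\<in>overpartitions n. F (residual_partition d xs)) = (\<Sum>(s, \<mu>, ys)\<in>?S. F \<mu>)"
  proof (rule sum.reindex_bij_witness[of _ "\<lambda>(s, \<mu>, ys). merge_residual d \<mu> ys"
        "\<lambda>xs. (sum_list (residual_partition d xs), residual_partition d xs, ?f xs)"])
    fix xs assume xs: "xs \<in> overpartitions n"
    show "(case (sum_list (residual_partition d xs), residual_partition d xs, ?f xs) of
      (s, \<mu>, ys) \<Rightarrow> merge_residual d \<mu> ys) = xs" using merge_filter[OF xs] by simp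
    obtain s where s: "d * s \<le> n" "residual_partition d xs \<in> partitions s" "?f xs \<in> residual_rest d (n - d * s)"
      using residual_split[OF xs assms] .
    then have "sum_list (residual_partition d xs) = s" by (simp add: partitions_def)
    moreover have "s \<le> n div d" using s(1) assms by (simp add: less_eq_div_iff_mult_less_eq mult.commute)
    ultimately show "(sum_list (residual_partition d xs), residual_partition d xs, ?f xs) \<in> ?S" using s by simp
  next
    fix p assume "p \<in> ?S"
    then obtain s \<mu> ys where p: "p = (s, \<mu>, ys)" "s \<le> n div d" "\<mu> \<in> partitions s" "ys \<in> residual_rest d (n - d * s)"
      by auto
    show "(sum_list (residual_partition d (case p of (s, \<mu>, ys) \<Rightarrow> merge_residual d \<mu> ys)),
      residual_partition d (case p of (s, \<mu>, ys) \<Rightarrow> merge_residual d \<mu> ys),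
      ?f (case p of (s, \<mu>, ys) \<Rightarrow> merge_residual d \<mu> ys)) = p"
      using p filter_merge_residual[OF p(3,4) assms] by (simp add: partitions_def)
    show "(case p of (s, \<mu>, ys) \<Rightarrow> merge_residual d \<mu> ys) \<in> overpartitions n"
      using merge_in_overpartitions[OF p(3,4) assms] p ds by simp
  qed simp
  also have "\<dots> = (\<Sum>s\<le>n div d. \<Sum>(\<mu>, ys)\<in>partitions s \<times> residual_rest d (n - d * s). F \<mu>)"
    by (subst sum.Sigma) (auto simp: finite_partitions finite_residual_rest)
  also have "\<dots> = (\<Sum>s\<le>n div d. \<Sum>\<mu>\<in>partitions s. \<Sum>ys\<in>residual_rest d (n - d * s). F \<mu>)"
    by (simp only: sum.cartesian_product)
  finally show ?thesis by (simp add: sum_distrib_right mult.commute)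
qed

lemma card_overpartitions:
  assumes "0 < d"
  shows "int (card (overpartitions n)) =
    (\<Sum>s\<le>n div d. int (card (partitions s)) * int (card (residual_rest d (n - d * s))))"
  using sum_overpartitions[OF assms, of "\<lambda>_. 1" n] by simp

lemma card_overpartitions_less: "card (overpartitions n) < card (overpartitions (Suc n))"
proof -
  let ?g = "\<lambda>xs. xs @ [(1, False)] :: (nat \<times> bool) list"
  have "card (overpartitions n) = card (?g ` overpartitions n)"
    by (rule card_image[symmetric]) (simp add: inj_on_def)
  also have "\<dots> < card (overpartitions (Suc n))"
  proof (rule psubset_card_mono[OF finite_overpartitions])
    have "?g xs \<in> overpartitions (Suc n)" if xs: "xs \<in> overpartitions n" for xs
    proof -
      have "op_key x \<le> op_key (1, False)" if "x \<in> set xs" for x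
        using xs that by (auto simp: overpartitions_iff op_key_def Suc_le_eq)
      then show ?thesis using xs by (simp add: overpartitions_iff sorted_append)
    qed
    then have "?g ` overpartitions n \<subseteq> overpartitions (Suc n)" by blast
    \<comment> \<open>Appending a plain 1 never produces the single overlined part, so the injection
      is not onto.\<close>
    moreover have "[(Suc n, True)] \<in> overpartitions (Suc n)" by (simp add: overpartitions_iff)
    moreover have "[(Suc n, True)] \<notin> ?g ` overpartitions n" by auto
    ultimately show "?g ` overpartitions n \<subset> overpartitions (Suc n)" by blast
  qed
  finally show ?thesis .
qed

lemma card_overpartitions_strict_mono: "m < n \<Longrightarrow> card (overpartitions m) < card (overpartitions n)"
  by (rule lift_Suc_mono_less[of "\<lambda>n. card (overpartitions n)", OF card_overpartitions_less])

lemma card_overpartitions_pos: "0 < card (overpartitions n)"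
proof -
  have "[] \<in> overpartitions 0" by (simp add: overpartitions_iff)
  then have "overpartitions 0 \<noteq> {}" by blast
  then have "0 < card (overpartitions 0)" using finite_overpartitions by (simp add: card_gt_0_iff)
  then show ?thesis using card_overpartitions_strict_mono[of 0 n] by (cases n) auto
qed

section \<open>The positive moments of the residual crank\<close>

lemma crank_weight_eq:
  "1 \<le> m \<Longrightarrow> crank_weight m \<mu> = (if crank1 \<mu> = m then 1 else 0)"
  by (auto simp: crank_weight_def crank1_def)

lemma pos_moment_eq_sum:
  "residual_crank_pos_moment d k n = (\<Sum>xs\<in>overpartitions n. crank_power k (residual_partition d xs))"
proof -
  let ?c = "\<lambda>xs. crank1 (residual_partition d xs)"
  let ?S = "{m. 1 \<le> m \<and> residual_crank_count d m n \<noteq> 0}"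
  \<comment> \<open>The support is enlarged by all positive cranks that occur, so that after
    swapping the sums each overpartition finds its own crank among the indices.\<close>
  let ?T = "?S \<union> {m \<in> ?c ` overpartitions n. 1 \<le> m}"
  have fin: "finite ?S" by (rule finite_subset[OF _ finite_residual_crank_count_support[of d n]]) auto
  then have finT: "finite ?T" by (simp add: finite_overpartitions)
  have "residual_crank_pos_moment d k n = (\<Sum>m\<in>?T. m ^ k * residual_crank_count d m n)"
    unfolding residual_crank_pos_moment_def by (rule sum.mono_neutral_left[OF finT]) auto
  also have "\<dots> = (\<Sum>m\<in>?T. \<Sum>xs\<in>overpartitions n. if ?c xs = m then m ^ k else 0)"
    unfolding residual_crank_count_def sum_distrib_left
    by (intro sum.cong refl) (auto simp: crank_weight_eq)
  also have "\<dots> = (\<Sum>xs\<in>overpartitions n. \<Sum>m\<in>?T. if ?c xs = m then m ^ k else 0)"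
    by (rule sum.swap)
  also have "\<dots> = (\<Sum>xs\<in>overpartitions n. crank_power k (residual_partition d xs))"
  proof (rule sum.cong)
    fix xs assume "xs \<in> overpartitions n"
    then have "?c xs \<in> ?T \<longleftrightarrow> 1 \<le> ?c xs" by auto
    then show "(\<Sum>m\<in>?T. if ?c xs = m then m ^ k else 0) = crank_power k (residual_partition d xs)"
      using finT by (simp add: crank_power_def)
  qed simp
  finally show ?thesis .
qed

text \<open>In the double sum over \<open>s\<close> and \<open>y\<close>, fixing \<open>y\<close>
  and summing over the rest reassembles the overpartitions of \<open>n - d * y\<close> from their
  split into residual partition and remainder.\<close>

lemma pos_moment_eq:
  assumes "1 \<le> d" "1 \<le> k"
  shows "residual_crank_pos_moment d k n =
    (\<Sum>y=1..n div d. run_coeff k y * int (card (overpartitions (n - d * y))))"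
proof -
  let ?p = "\<lambda>s. int (card (partitions s))" and ?a = "\<lambda>r. int (card (residual_rest d r))"
  let ?N = "n div d"
  have d: "0 < d" using assms by simp
  have "residual_crank_pos_moment d k n = (\<Sum>s\<le>?N. (\<Sum>y=1..s. run_coeff k y * ?p (s - y)) * ?a (n - d * s))"
    unfolding pos_moment_eq_sum sum_overpartitions[OF d] sum_crank_power[OF assms(2)] ..
  also have "\<dots> = (\<Sum>s\<le>?N. \<Sum>y=1..s. run_coeff k y * (?p (s - y) * ?a (n - d * s)))"
    by (simp add: sum_distrib_right mult.assoc)
  also have "\<dots> = (\<Sum>(s, y)\<in>(SIGMA s:{..?N}. {1..s}). run_coeff k y * (?p (s - y) * ?a (n - d * s)))"
    by (rule sum.Sigma) auto
  \<comment> \<open>Substitution \<open>s = y + t\<close> with \<open>y\<close> as the outer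
    index.\<close>
  also have "\<dots> = (\<Sum>(y, t)\<in>(SIGMA y:{1..?N}. {..?N - y}). run_coeff k y * (?p t * ?a (n - d * (y + t))))"
    by (rule sum.reindex_bij_witness[of _ "\<lambda>(y, t). (y + t, y)" "\<lambda>(s, y). (y, s - y)"]) auto
  also have "\<dots> = (\<Sum>y=1..?N. \<Sum>t\<le>?N - y. run_coeff k y * (?p t * ?a (n - d * (y + t))))"
    by (rule sum.Sigma[symmetric]) auto
  also have "\<dots> = (\<Sum>y=1..?N. run_coeff k y * int (card (overpartitions (n - d * y))))"
  proof (rule sum.cong)
    fix y assume "y \<in> {1..?N}"
    then have "d * y \<le> n" using d by (simp add: less_eq_div_iff_mult_less_eq mult.commute)
    then have "(n - d * y) div d = ?N - y"
      using div_mult_self2[of d "n - d * y" y] d by simp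
    moreover have "n - d * (y + t) = n - d * y - d * t" for t by (simp add: algebra_simps)
    ultimately show "(\<Sum>t\<le>?N - y. run_coeff k y * (?p t * ?a (n - d * (y + t)))) =
      run_coeff k y * int (card (overpartitions (n - d * y)))"
      by (simp add: card_overpartitions[OF d] sum_distrib_left)
  qed simp
  finally show ?thesis .
qed

lemma pos_moment_pos:
  assumes "1 \<le> d" "1 \<le> k" "d \<le> n"
  shows "0 < residual_crank_pos_moment d k n"
proof -
  have N: "1 \<le> n div d" using assms by (simp add: div_greater_zero_iff Suc_le_eq)
  show ?thesis unfolding pos_moment_eq[OF assms(1,2)]
    using card_overpartitions_pos[of "n - d * 1"] run_coeff_nonneg[of k] run_coeff_1[OF assms(2)] N
    by (intro sum_pos2[of _ 1]) auto
qed

lemma pos_moment_less: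
  assumes "1 \<le> d" "1 \<le> k" "d \<le> n"
  shows "residual_crank_pos_moment (d + 1) k n < residual_crank_pos_moment d k n"
proof -
  let ?o = "\<lambda>m. int (card (overpartitions m))"
  let ?N = "n div d" and ?M = "n div (d + 1)"
  have MN: "?M \<le> ?N" using assms by (intro div_le_mono2) auto
  have N: "1 \<le> ?N" using assms by (simp add: div_greater_zero_iff Suc_le_eq)
  \<comment> \<open>Zero padding beyond \<open>?M\<close> lets both moments be compared term by term
    over \<open>1..?N\<close>; the term \<open>y = 1\<close>, whose coefficient is 1, makes the
    inequality strict.\<close>
  let ?t = "\<lambda>y. if y \<le> ?M then ?o (n - (d + 1) * y) else 0"
  have lt: "?t y < ?o (n - d * y)" if "1 \<le> y" "y \<le> ?N" for y
  proof (cases "y \<le> ?M")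
    case True
    then have "(d + 1) * y \<le> n" by (simp add: less_eq_div_iff_mult_less_eq mult.commute)
    then have "n - (d + 1) * y < n - d * y" using that by simp
    then show ?thesis using True card_overpartitions_strict_mono by simp
  next
    case False
    then show ?thesis using card_overpartitions_pos by simp
  qed
  have "residual_crank_pos_moment (d + 1) k n = (\<Sum>y=1..?M. run_coeff k y * ?t y)"
    using pos_moment_eq[of "d + 1" k n] assms by simp
  also have "\<dots> = (\<Sum>y=1..?N. run_coeff k y * ?t y)"
    using MN by (intro sum.mono_neutral_left) auto
  also have "\<dots> < (\<Sum>y=1..?N. run_coeff k y * ?o (n - d * y))"
  proof (rule sum_strict_mono_ex1)
    show "\<forall>y\<in>{1..?N}. run_coeff k y * ?t y \<le> run_coeff k y * ?o (n - d * y)"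
      using mult_left_mono[OF less_imp_le[OF lt] run_coeff_nonneg] by simp
    show "\<exists>y\<in>{1..?N}. run_coeff k y * ?t y < run_coeff k y * ?o (n - d * y)"
      using lt[of 1] N run_coeff_1[OF assms(2)] by (intro bexI[of _ 1]) auto
  qed simp
  also have "\<dots> = residual_crank_pos_moment d k n" using pos_moment_eq[of d k n] assms by simp
  finally show ?thesis .
qed

lemma pos_moment_small:
  assumes "1 \<le> d" "1 \<le> k" "n < d"
  shows "residual_crank_pos_moment d k n = 0"
  using assms by (simp add: pos_moment_eq)

theorem theorem1:
  fixes d k n :: nat
  assumes "d \<ge> 1" and "k \<ge> 1"
  shows "residual_crank_pos_moment (d + 1) k n \<le> residual_crank_pos_moment d k n \<and>
    (residual_crank_pos_moment (d + 1) k n = residual_crank_pos_moment d k n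
       \<longleftrightarrow> residual_crank_pos_moment d k n = 0) \<and>
    (residual_crank_pos_moment d k n = 0 \<longleftrightarrow> n < d)"
proof (cases "n < d")
  case True
  then show ?thesis using assms pos_moment_small[of d k n] pos_moment_small[of "d + 1" k n] by simp
next
  case False
  then show ?thesis using assms pos_moment_less[of d k n] pos_moment_pos[of d k n] by simp
qed

end
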